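(* Let $G$ be a totally disconnected second countable locally compact group with the Howe–Moore property, and assume $G$ is non-amenable. Then $G$ has Property $(T_{\ell_p})$ for every $1<p<\infty$, $p\neq2$.
   Context: $G$ has the Howe–Moore property if for every unitary representation $\pi$ of $G$ without non-zero invariant vectors, all matrix coefficients $g\mapsto\langle\pi(g)\xi,\eta\rangle$ vanish at infinity on $G$. All Banach spaces are complex; $\ell_p=\ell_p(\mathbf N)$, $q$ the conjugate exponent, $\mathbf O(\ell_p)$ the group of linear bijective isometries. An orthogonal representation of $G$ on $\ell_p$ is a strongly continuous homomorphism $\pi:G\to\mathbf O(\ell_p)$. A sequence of almost invariant vectors is a sequence of unit vectors $f_n$ with $\|\pi(g)f_n-f_n\|\to0$ uniformly on compact subsets. With $\pi^*$ the dual representation on $\ell_q$, $\ell'_p(\pi)$ is the annihilator in $\ell_p$ of the $\pi^*(G)$-invariant vectors of $\ell_q$. $G$ has Property $(T_{\ell_p})$ if for no orthogonal representation $\pi$ on $\ell_p$ does $\ell'_p(\pi)$ contain a sequence of almost invariant vectors. *)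

theory Defs
  imports "HOL-Analysis.Analysis"
begin

text \<open>Groups are written additively: a (not necessarily commutative) topological group
  is a type of class topological_group_add (group_add does not assume commutativity).\<close>

definition lp :: "real \<Rightarrow> (nat \<Rightarrow> complex) set" where
  "lp p = {f. summable (\<lambda>n. norm (f n) powr p)}"

definition lpnorm :: "real \<Rightarrow> (nat \<Rightarrow> complex) \<Rightarrow> real" where
  "lpnorm p f = (\<Sum>n. norm (f n) powr p) powr (1 / p)"

definition conj_exp :: "real \<Rightarrow> real" where
  "conj_exp p = p / (p - 1)"

definition pairing :: "(nat \<Rightarrow> complex) \<Rightarrow> (nat \<Rightarrow> complex) \<Rightarrow> complex" where
  "pairing f h = (\<Sum>n. f n * h n)"

definition l2inner :: "(nat \<Rightarrow> complex) \<Rightarrow> (nat \<Rightarrow> complex) \<Rightarrow> complex" where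
  "l2inner f h = (\<Sum>n. f n * cnj (h n))"

definition lp_isometry :: "real \<Rightarrow> ((nat \<Rightarrow> complex) \<Rightarrow> (nat \<Rightarrow> complex)) \<Rightarrow> bool" where
  "lp_isometry p T \<longleftrightarrow>
     (\<forall>f\<in>lp p. \<forall>h\<in>lp p. \<forall>a b::complex. T (\<lambda>n. a * f n + b * h n) = (\<lambda>n. a * T f n + b * T h n))
   \<and> bij_betw T (lp p) (lp p)
   \<and> (\<forall>f\<in>lp p. lpnorm p (T f) = lpnorm p f)"

text \<open>Orthogonal representation of G on l_p: strongly continuous homomorphism G -> O(l_p).
  Maps are only relevant on l_p.\<close>
definition orth_rep :: "real \<Rightarrow> ('g::topological_group_add \<Rightarrow> (nat \<Rightarrow> complex) \<Rightarrow> (nat \<Rightarrow> complex)) \<Rightarrow> bool" where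
  "orth_rep p \<pi> \<longleftrightarrow>
     (\<forall>g. lp_isometry p (\<pi> g))
   \<and> (\<forall>g h. \<forall>f\<in>lp p. \<pi> (g + h) f = \<pi> g (\<pi> h f))
   \<and> (\<forall>f\<in>lp p. \<pi> 0 f = f)
   \<and> (\<forall>f\<in>lp p. \<forall>g0. ((\<lambda>g. lpnorm p (\<lambda>n. \<pi> g f n - \<pi> g0 f n)) \<longlongrightarrow> 0) (at g0))"

abbreviation unitary_rep :: "('g::topological_group_add \<Rightarrow> (nat \<Rightarrow> complex) \<Rightarrow> (nat \<Rightarrow> complex)) \<Rightarrow> bool" where
  "unitary_rep \<pi> \<equiv> orth_rep 2 \<pi>"

text \<open>Dual representation pi^* on l_q: pi^*(g) = pi(g^{-1})^t, i.e.
  <f, pi^*(g) h> = <pi(g^{-1}) f, h> for all f in l_p.\<close>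
definition dual_rep :: "real \<Rightarrow> ('g::topological_group_add \<Rightarrow> (nat \<Rightarrow> complex) \<Rightarrow> (nat \<Rightarrow> complex))
    \<Rightarrow> 'g \<Rightarrow> (nat \<Rightarrow> complex) \<Rightarrow> (nat \<Rightarrow> complex)" where
  "dual_rep p \<pi> g h = (THE h'. h' \<in> lp (conj_exp p) \<and>
      (\<forall>f\<in>lp p. pairing f h' = pairing (\<pi> (- g) f) h))"

definition lp_prime :: "real \<Rightarrow> ('g::topological_group_add \<Rightarrow> (nat \<Rightarrow> complex) \<Rightarrow> (nat \<Rightarrow> complex))
    \<Rightarrow> (nat \<Rightarrow> complex) set" where
  "lp_prime p \<pi> = {f \<in> lp p. \<forall>h \<in> lp (conj_exp p).
      (\<forall>g. dual_rep p \<pi> g h = h) \<longrightarrow> pairing f h = 0}"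

definition almost_invariant_seq :: "real \<Rightarrow> ('g::topological_group_add \<Rightarrow> (nat \<Rightarrow> complex) \<Rightarrow> (nat \<Rightarrow> complex))
    \<Rightarrow> (nat \<Rightarrow> nat \<Rightarrow> complex) \<Rightarrow> bool" where
  "almost_invariant_seq p \<pi> F \<longleftrightarrow>
     (\<forall>k. F k \<in> lp p \<and> lpnorm p (F k) = 1)
   \<and> (\<forall>K. compact K \<longrightarrow> (\<forall>\<epsilon>>0. \<exists>N. \<forall>k\<ge>N. \<forall>g\<in>K.
         lpnorm p (\<lambda>n. \<pi> g (F k) n - F k n) < \<epsilon>))"

definition property_T_lp :: "real \<Rightarrow> 'g::topological_group_add itself \<Rightarrow> bool" where
  "property_T_lp p _ \<longleftrightarrow>
     (\<forall>\<pi> :: 'g \<Rightarrow> (nat \<Rightarrow> complex) \<Rightarrow> (nat \<Rightarrow> complex). orth_rep p \<pi> \<longrightarrow>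
        \<not> (\<exists>F. (\<forall>k. F k \<in> lp_prime p \<pi>) \<and> almost_invariant_seq p \<pi> F))"

definition vanishes_at_infinity :: "('g::topological_space \<Rightarrow> complex) \<Rightarrow> bool" where
  "vanishes_at_infinity c \<longleftrightarrow>
     (\<forall>\<epsilon>>0. \<exists>K. compact K \<and> (\<forall>g. g \<notin> K \<longrightarrow> norm (c g) < \<epsilon>))"

definition howe_moore :: "'g::topological_group_add itself \<Rightarrow> bool" where
  "howe_moore _ \<longleftrightarrow>
     (\<forall>\<pi> :: 'g \<Rightarrow> (nat \<Rightarrow> complex) \<Rightarrow> (nat \<Rightarrow> complex). unitary_rep \<pi> \<longrightarrow>
        \<not> (\<exists>\<xi>\<in>lp 2. \<xi> \<noteq> (\<lambda>n. 0) \<and> (\<forall>g. \<pi> g \<xi> = \<xi>)) \<longrightarrow>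
        (\<forall>\<xi>\<in>lp 2. \<forall>\<eta>\<in>lp 2. vanishes_at_infinity (\<lambda>g. l2inner (\<pi> g \<xi>) \<eta>)))"

definition bcont :: "('g::topological_space \<Rightarrow> real) \<Rightarrow> bool" where
  "bcont f \<longleftrightarrow> bounded (range f) \<and> continuous_on UNIV f"

definition amenable :: "'g::topological_group_add itself \<Rightarrow> bool" where
  "amenable _ \<longleftrightarrow> (\<exists>m :: ('g \<Rightarrow> real) \<Rightarrow> real.
      (\<forall>f h a b. bcont f \<longrightarrow> bcont h \<longrightarrow> m (\<lambda>x. a * f x + b * h x) = a * m f + b * m h)
    \<and> (\<forall>f. bcont f \<longrightarrow> (\<forall>x. f x \<ge> 0) \<longrightarrow> m f \<ge> 0)
    \<and> m (\<lambda>x. 1) = 1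
    \<and> (\<forall>f g. bcont f \<longrightarrow> m (\<lambda>x. f (g + x)) = m f))"

definition totally_disconnected :: "'g::topological_space itself \<Rightarrow> bool" where
  "totally_disconnected _ \<longleftrightarrow> (\<forall>x::'g. connected_component_set UNIV x = {x})"

end

theory Submission
  imports Defs
begin

text \<open>For \<open>p \<noteq> 2\<close> the Banach--Lamperti theorem makes an orthogonal representation on \<open>l\<^sub>p\<close> monomial:
  \<open>G\<close> permutes the unit vectors up to phases, with open stabilisers by strong continuity.
  The Howe--Moore property, applied to \<open>l\<^sub>2\<close> of an orbit, forces every stabiliser to be compact
  unless the orbit is a single point, and forces the phase character of a fixed point to be trivial,
  so that vectors of \<open>l'\<^sub>p\<close> vanish at fixed points. If \<open>f\<^sub>k\<close> were almost invariant in \<open>l'\<^sub>p\<close>, the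
  probability vectors \<open>\<bar>f\<^sub>k\<bar>\<^sup>p\<close> would be almost invariant in \<open>l\<^sub>1\<close> of a \<open>G\<close>-set with compact open
  stabilisers; averaging functions on \<open>G\<close> over the cosets of the stabilisers and passing to a
  cluster point turns them into an invariant mean on \<open>G\<close>, contradicting non-amenability.\<close>

section \<open>Compact open subgroups\<close>

text \<open>The Howe-Moore property is encoded for representations on the infinite-dimensional space
  \<open>l\<^sub>2\<close>, whereas fixed points and finite orbits give finite-dimensional ones.
  Countably many copies of a unitary matrix representation fit on \<open>l\<^sub>2\<close>. The
  columns of a unitary matrix have norm 1, so its entries cannot all be small, and vanishing
  coefficients would make G compact. Compactness is excluded because it yields an invariant mean;
  hence an orbit with at least two points is infinite.

  Taking moduli removes the phases, so they have to be controlled at fixed points only. There a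
  trivial phase makes the unit vector invariant under the dual representation, and
  \<open>lp_prime\<close> annihilates such vectors.

  Averaging over a coset needs an invariant mean on a compact open stabiliser H. It is obtained
  without Haar measure, as a cluster point of uniform averages over the finite coset spaces H/U, for
  compact open subgroups U shrinking to 0. Since orbits are discrete, averaging may produce any
  bounded function on an orbit; therefore the final mean is defined and invariant on all bounded
  continuous functions at once, not only on uniformly continuous ones.\<close>

lemma bounded_functionals_cluster:
  fixes m :: "nat \<Rightarrow> 'f \<Rightarrow> real"
  assumes bd: "\<And>k f. \<bar>m k f\<bar> \<le> B f"
  obtains L F where "F \<noteq> bot" "F \<le> sequentially" "\<And>f. ((\<lambda>k. m k f) \<longlongrightarrow> L f) F"
proof -
  \<comment> \<open>By Tychonoff's theorem this product of intervals is compact for pointwise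
    convergence.\<close>
  let ?S = "PiE UNIV (\<lambda>f. cball 0 (B f)) :: ('f \<Rightarrow> real) set"
  have "compactin (product_topology (\<lambda>i::'f. euclideanreal) UNIV) ?S"
    by (simp add: compactin_PiE)
  hence "compact ?S"
    by (simp add: euclidean_product_topology)
  moreover have "eventually (\<lambda>x. x \<in> ?S) (filtermap m sequentially)"
    using bd by (simp add: eventually_filtermap PiE_def)
  moreover have "filtermap m sequentially \<noteq> bot"
    by (simp add: filtermap_bot_iff)
  ultimately obtain L where L: "inf (nhds L) (filtermap m sequentially) \<noteq> bot"
    unfolding compact_filter by blast
  \<comment> \<open>\<open>F\<close> plays the part of a convergent subsequence, which need not
    exist when \<open>'f\<close> is uncountable. It is finer than \<open>sequentially\<close>, so
    ordinary limits survive along it.\<close>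
  define F where "F = inf (filtercomap m (nhds L)) sequentially"
  have "F \<noteq> bot"
  proof
    assume "F = bot"
    hence "eventually (\<lambda>_. False) F" by simp
    then obtain P Q where P: "eventually P (nhds L)" and Q: "eventually Q sequentially"
      and PQ: "\<And>k. P (m k) \<Longrightarrow> Q k \<Longrightarrow> False"
      unfolding F_def eventually_inf eventually_filtercomap by blast
    have "eventually (\<lambda>x. \<not> P x) (filtermap m sequentially)"
      unfolding eventually_filtermap using Q by eventually_elim (use PQ in blast)
    with P have "eventually (\<lambda>_. False) (inf (nhds L) (filtermap m sequentially))"
      unfolding eventually_inf by blast
    with L show False by (simp add: trivial_limit_def)
  qed
  moreover have "F \<le> sequentially" by (simp add: F_def)
  moreover have "((\<lambda>k. m k f) \<longlongrightarrow> L f) F" for f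
  proof -
    have "filterlim m (nhds L) F"
      unfolding F_def by (rule filterlim_mono[OF filterlim_filtercomap[of m "nhds L"]]) auto
    moreover have "((\<lambda>x. x f) \<longlongrightarrow> L f) (nhds L)"
      using continuous_on_product_coordinates[of f]
      by (metis UNIV_I continuous_on_def tendsto_at_iff_tendsto_nhds)
    ultimately show ?thesis
      using filterlim_compose by blast
  qed
  ultimately show ?thesis using that by blast
qed

section \<open>Open subgroups and van Dantzig's theorem\<close>

definition open_subgroup :: "'g::topological_group_add set \<Rightarrow> bool" where
  "open_subgroup U \<longleftrightarrow> open U \<and> 0 \<in> U \<and> (\<forall>x\<in>U. \<forall>y\<in>U. x + y \<in> U) \<and> (\<forall>x\<in>U. - x \<in> U)"

lemma open_translate:
  fixes S :: "'g::topological_group_add set"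
  assumes "open S"
  shows "open {x. a + x \<in> S}"
proof -
  have "continuous_on UNIV (\<lambda>x. a + x)" by (intro continuous_intros)
  thus ?thesis using open_vimage[OF assms] by (simp add: vimage_def)
qed

lemma open_uminus_vimage:
  fixes S :: "'g::topological_group_add set"
  assumes "open S"
  shows "open {x. - x \<in> S}"
proof -
  have "continuous_on UNIV (\<lambda>x::'g. - x)" by (intro continuous_intros)
  thus ?thesis using open_vimage[OF assms] by (simp add: vimage_def)
qed

text \<open>The complement is a union of left cosets \<open>x + U\<close>, each of them
  open.\<close>

lemma open_subgroup_closed:
  fixes U :: "'g::topological_group_add set"
  assumes "open_subgroup U"
  shows "closed U"
proof -
  have "\<exists>T. open T \<and> x \<in> T \<and> T \<subseteq> - U" if "x \<notin> U" for x
  proof (intro exI conjI)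
    show "open {y. - x + y \<in> U}"
      using assms by (simp add: open_translate open_subgroup_def)
    show "x \<in> {y. - x + y \<in> U}" using assms by (simp add: open_subgroup_def)
    show "{y. - x + y \<in> U} \<subseteq> - U"
    proof safe
      fix y assume "- x + y \<in> U" "y \<in> U"
      hence "y + - (- x + y) \<in> U" using assms unfolding open_subgroup_def by blast
      moreover have "y + - (- x + y) = x" by (simp add: minus_add add.assoc[symmetric])
      ultimately show False using that by simp
    qed
  qed
  thus ?thesis unfolding closed_def by (subst open_subopen) blast
qed

lemma open_subgroupI:
  fixes U :: "'g::topological_group_add set"
  assumes "open V" "0 \<in> V" "V \<subseteq> U"
    and add: "\<And>x y. x \<in> U \<Longrightarrow> y \<in> U \<Longrightarrow> x + y \<in> U" and uminus: "\<And>x. x \<in> U \<Longrightarrow> - x \<in> U"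
  shows "open_subgroup U"
proof -
  have "\<exists>T. open T \<and> x \<in> T \<and> T \<subseteq> U" if "x \<in> U" for x
  proof (intro exI conjI)
    show "open {y. - x + y \<in> V}" using assms(1) by (rule open_translate)
    show "x \<in> {y. - x + y \<in> V}" using assms(2) by simp
    show "{y. - x + y \<in> V} \<subseteq> U"
    proof safe
      fix y assume "- x + y \<in> V"
      hence "x + (- x + y) \<in> U" using that add assms(3) by blast
      thus "y \<in> U" by (simp add: add.assoc[symmetric])
    qed
  qed
  hence "open U" by (subst open_subopen) blast
  thus ?thesis using assms unfolding open_subgroup_def by blast
qed

text \<open>In a compact Hausdorff space, a point whose component is trivial can be separated from a
  disjoint closed set by a partition into two open sets. This is applied inside a compact
  neighbourhood K, to x and the part of K outside \<open>W \<inter> V\<close>.\<close>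

lemma clopen_nhd_basis:
  fixes V :: "'g::{topological_space, t2_space} set"
  assumes lc: "locally compact (UNIV :: 'g set)" and td: "totally_disconnected TYPE('g)"
    and V: "open V" "x \<in> V"
  obtains A where "open A" "compact A" "x \<in> A" "A \<subseteq> V"
proof -
  obtain W K where W: "open W" "x \<in> W" "W \<subseteq> K" and K: "compact K"
    using lc[unfolded locally_def, rule_format, of UNIV x] by auto
  let ?X = "top_of_set K" and ?T = "K - (W \<inter> V)"
  have "separated_between ?X {x} ?T"
  proof (rule cut_wire_fence_theorem)
    show "compact_space ?X" using K by (simp add: compact_space_subtopology)
    show "Hausdorff_space ?X"
      unfolding Hausdorff_space_def
    proof (intro allI impI, elim conjE)
      fix y z assume yz: "y \<in> topspace ?X" "z \<in> topspace ?X" "y \<noteq> z"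
      obtain S T where "open S" "open T" "y \<in> S" "z \<in> T" "S \<inter> T = {}"
        using hausdorff[OF yz(3)] by blast
      thus "\<exists>U V. openin ?X U \<and> openin ?X V \<and> y \<in> U \<and> z \<in> V \<and> disjnt U V"
        using yz by (intro exI[of _ "K \<inter> S"] exI[of _ "K \<inter> T"]) (auto simp: disjnt_def)
    qed
    have "x \<in> K" using W by blast
    thus "closedin ?X {x}" by (simp add: closed_subset)
    show "closedin ?X ?T"
      using W(1) V(1) K compact_imp_closed[OF K] by (intro closed_subset) (auto intro!: closed_Diff)
    show "disjnt C {x} \<or> disjnt C ?T" if C: "connectedin ?X C" for C
    proof (cases "x \<in> C")
      case True
      have "connected C" using C by (simp add: connectedin_subtopology)
      hence "C \<subseteq> connected_component_set UNIV x"
        using True by (intro connected_component_maximal) auto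
      hence "C \<subseteq> {x}" using td by (simp add: totally_disconnected_def)
      thus ?thesis using W V by (auto simp: disjnt_def)
    qed (auto simp: disjnt_def)
  qed
  then obtain A B where A: "openin ?X A" and B: "openin ?X B" and AB: "A \<union> B = K" "disjnt A B"
    and xA: "x \<in> A" and TB: "?T \<subseteq> B"
    unfolding separated_between_def by auto
  have AWV: "A \<subseteq> W \<inter> V" using AB TB by (auto simp: disjnt_def)
  obtain S where S: "open S" "A = K \<inter> S" using A by (auto simp: openin_open)
  \<comment> \<open>The piece \<open>A\<close> is so far open only relative to K. It lies in the
    open set \<open>W \<subseteq> K\<close>, which makes it open in the whole space.\<close>
  have "A = S \<inter> W \<inter> V" using S AWV W(3) by blast
  hence "open A" using S W V by (metis open_Int)
  moreover have "compact A"
  proof -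
    have "A = K - B" using AB by (auto simp: disjnt_def)
    moreover obtain S' where "open S'" "B = K \<inter> S'" using B by (auto simp: openin_open)
    ultimately have "A = K - S'" by blast
    thus ?thesis using K \<open>open S'\<close> by (simp add: compact_diff)
  qed
  ultimately show ?thesis using that xA AWV by blast
qed

lemma tube_translate:
  fixes K W :: "'g::topological_group_add set"
  assumes "compact K" "open W" "K \<subseteq> W"
  obtains V where "open V" "0 \<in> V" "\<And>a v. a \<in> K \<Longrightarrow> v \<in> V \<Longrightarrow> a + v \<in> W"
proof -
  have "continuous_on UNIV (\<lambda>z::'g\<times>'g. snd z + fst z)" by (intro continuous_intros)
  hence op: "open ((\<lambda>z::'g\<times>'g. snd z + fst z) -` W)" using assms open_vimage by blast
  have "{0} \<times> K \<subseteq> (\<lambda>z::'g\<times>'g. snd z + fst z) -` W" using assms(3) by auto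
  from Elementary_Topology.tube_lemma[OF assms(1) op this]
  obtain V where V: "0 \<in> V" "open V" "V \<times> K \<subseteq> (\<lambda>z::'g\<times>'g. snd z + fst z) -` W" by blast
  show ?thesis by (rule that[OF V(2,1)]) (use V(3) in auto)
qed

text \<open>A compact open neighbourhood A of 0 is turned into a subgroup by taking all u for which
  right translation by u and by -u maps A into itself. Compactness of A makes this set contain a
  neighbourhood of 0, and \<open>0 \<in> A\<close> forces it into A.\<close>

theorem van_Dantzig:
  fixes V :: "'g::{topological_group_add, t2_space} set"
  assumes lc: "locally compact (UNIV :: 'g set)" and td: "totally_disconnected TYPE('g)"
    and V: "open V" "0 \<in> V"
  obtains U where "open_subgroup U" "compact U" "U \<subseteq> V"
proof -
  obtain A where A: "open A" "compact A" "0 \<in> A" "A \<subseteq> V"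
    using clopen_nhd_basis[OF lc td V] by blast
  obtain W where W: "open W" "0 \<in> W" "\<And>a v. a \<in> A \<Longrightarrow> v \<in> W \<Longrightarrow> a + v \<in> A"
    using tube_translate[OF A(2,1)] by blast
  define U where "U = {u. (\<forall>a\<in>A. a + u \<in> A) \<and> (\<forall>a\<in>A. a + - u \<in> A)}"
  have "open_subgroup U"
  proof (rule open_subgroupI)
    show "open (W \<inter> {x. - x \<in> W})" using W open_uminus_vimage by blast
    show "0 \<in> W \<inter> {x. - x \<in> W}" using W by simp
    show "W \<inter> {x. - x \<in> W} \<subseteq> U" using W by (auto simp: U_def simp del: add_uminus_conv_diff)
    show "x + y \<in> U" if "x \<in> U" "y \<in> U" for x y
      using that by (auto simp: U_def minus_add add.assoc[symmetric] simp del: add_uminus_conv_diff)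
    show "- x \<in> U" if "x \<in> U" for x
      using that by (auto simp: U_def)
  qed
  moreover have "U \<subseteq> A" using A(3) by (force simp: U_def)
  moreover from this have "compact U"
    using open_subgroup_closed[OF calculation(1)] A(2)
    by (metis closed_Int_compact inf.absorb_iff1)
  ultimately show ?thesis using that A(4) by blast
qed

text \<open>\<open>\<rho>\<close> picks a representative of the left coset \<open>x + U\<close>. The
  compact set H meets only finitely many of these open cosets, and left translation by h permutes
  them; the last conclusion records that permutation on the representatives.\<close>

lemma finite_transversal:
  fixes H U :: "'g::topological_group_add set"
  assumes H: "open_subgroup H" "compact H" and U: "open_subgroup U" "U \<subseteq> H"
  obtains T \<rho> where "finite T" "T \<noteq> {}" "T \<subseteq> H" "\<And>x. x \<in> H \<Longrightarrow> \<rho> x \<in> T \<and> - \<rho> x + x \<in> U"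
    "\<And>h. h \<in> H \<Longrightarrow> bij_betw (\<lambda>t. \<rho> (h + t)) T T"
proof -
  define \<rho> where "\<rho> x = (SOME y. y \<in> H \<and> - x + y \<in> U)" for x
  define T where "T = \<rho> ` H"
  have U0: "0 \<in> U" and Uadd: "\<And>x y. x \<in> U \<Longrightarrow> y \<in> U \<Longrightarrow> x + y \<in> U" and Um: "\<And>x. x \<in> U \<Longrightarrow> - x \<in> U"
    using U by (auto simp: open_subgroup_def)
  have Hadd: "\<And>x y. x \<in> H \<Longrightarrow> y \<in> H \<Longrightarrow> x + y \<in> H" and H0: "0 \<in> H"
    using H by (auto simp: open_subgroup_def)
  have \<rho>: "\<rho> x \<in> H \<and> - x + \<rho> x \<in> U" if "x \<in> H" for x
    unfolding \<rho>_def by (rule someI[of _ x]) (use that U0 in simp)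
  have \<rho>': "- \<rho> x + x \<in> U" if "x \<in> H" for x
    using Um[OF conjunct2[OF \<rho>[OF that]]] by (simp add: minus_add)
  \<comment> \<open>Points of one coset give the choice operator the same predicate, hence the same
    representative.\<close>
  have eq: "\<rho> x = \<rho> y" if "- x + y \<in> U" for x y
  proof -
    have "- y + z \<in> U" if z: "- x + z \<in> U" for z
    proof -
      have "- (- x + y) + (- x + z) \<in> U" using Uadd Um \<open>- x + y \<in> U\<close> z by blast
      thus ?thesis by (simp add: minus_add add.assoc)
    qed
    moreover have "- x + z \<in> U" if z: "- y + z \<in> U" for z
    proof -
      have "(- x + y) + (- y + z) \<in> U" using Uadd \<open>- x + y \<in> U\<close> z by blast
      thus ?thesis by (simp add: add.assoc)
    qed
    ultimately show ?thesis unfolding \<rho>_def by metis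
  qed
  have finT: "finite T"
  proof -
    have "\<forall>x\<in>H. open {y. - x + y \<in> U}" using U open_translate by (auto simp: open_subgroup_def)
    moreover have "H \<subseteq> (\<Union>x\<in>H. {y. - x + y \<in> U})" using U0 by auto
    ultimately obtain S where S: "S \<subseteq> H" "finite S" "H \<subseteq> (\<Union>x\<in>S. {y. - x + y \<in> U})"
      using H(2) compactE_image[of H H "\<lambda>x. {y. - x + y \<in> U}"] by metis
    have "T \<subseteq> \<rho> ` S"
    proof
      fix t assume "t \<in> T"
      then obtain h where h: "h \<in> H" "t = \<rho> h" by (auto simp: T_def)
      then obtain s where "s \<in> S" "- s + h \<in> U" using S(3) by auto
      hence "\<rho> s = t" using eq h(2) by blast
      thus "t \<in> \<rho> ` S" using \<open>s \<in> S\<close> by blast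
    qed
    thus ?thesis using S(2) finite_surj by blast
  qed
  have TH: "T \<subseteq> H" using \<rho> by (auto simp: T_def)
  have fix_T: "\<rho> t = t" if t: "t \<in> T" for t
  proof -
    obtain h where h: "h \<in> H" "t = \<rho> h" using t unfolding T_def by blast
    have "\<rho> h = \<rho> t" using h \<rho>[of h] by (intro eq) simp
    thus ?thesis using h by simp
  qed
  have "bij_betw (\<lambda>t. \<rho> (h + t)) T T" if h: "h \<in> H" for h
  proof -
    have "inj_on (\<lambda>t. \<rho> (h + t)) T"
    proof (rule inj_onI)
      fix s t assume s: "s \<in> T" and t: "t \<in> T" and e: "\<rho> (h + s) = \<rho> (h + t)"
      have "- (h + s) + \<rho> (h + s) \<in> U" "- \<rho> (h + t) + (h + t) \<in> U"
        using s t h TH Hadd \<rho> \<rho>' by auto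
      hence "- (h + s) + \<rho> (h + s) + (- \<rho> (h + t) + (h + t)) \<in> U" using Uadd by blast
      moreover have "- (h + s) + \<rho> (h + s) + (- \<rho> (h + t) + (h + t)) = - s + t"
        unfolding e by (simp add: minus_add add.assoc del: add_uminus_conv_diff)
      ultimately have "- s + t \<in> U" by metis
      hence "\<rho> s = \<rho> t" by (rule eq)
      thus "s = t" using fix_T s t by simp
    qed
    moreover have "(\<lambda>t. \<rho> (h + t)) ` T \<subseteq> T" using h TH Hadd by (auto simp: T_def)
    ultimately show ?thesis using finT by (simp add: bij_betw_def endo_inj_surj)
  qed
  thus ?thesis using that[OF finT _ TH] \<rho>' H0 unfolding T_def by blast
qed

section \<open>Invariant means\<close>

text \<open>Positivity is tested on S only: this is a mean concentrated on S, yet applied to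
  functions on the whole group, so that nothing has to be restricted or extended. For
  \<open>S = UNIV\<close> it is an ordinary mean.\<close>

definition mean_on :: "'g::topological_space set \<Rightarrow> (('g \<Rightarrow> real) \<Rightarrow> real) \<Rightarrow> bool" where
  "mean_on S m \<longleftrightarrow>
     (\<forall>f h a b. bcont f \<longrightarrow> bcont h \<longrightarrow> m (\<lambda>x. a * f x + b * h x) = a * m f + b * m h)
   \<and> (\<forall>f. bcont f \<longrightarrow> (\<forall>x\<in>S. f x \<ge> 0) \<longrightarrow> m f \<ge> 0)
   \<and> m (\<lambda>x. 1) = 1"

lemma bcont_iff: "bcont f \<longleftrightarrow> (\<exists>C. \<forall>x. \<bar>f x\<bar> \<le> C) \<and> continuous_on UNIV f"
  by (auto simp: bcont_def bounded_iff)

lemma bcont_const: "bcont (\<lambda>x. c)"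
  by (auto simp: bcont_iff)

lemma bcont_lincomb:
  assumes "bcont f" "bcont h"
  shows "bcont (\<lambda>x. a * f x + b * h x)"
proof -
  obtain C D where C: "\<And>x. \<bar>f x\<bar> \<le> C" and D: "\<And>x. \<bar>h x\<bar> \<le> D" using assms by (auto simp: bcont_iff)
  have "\<bar>a * f x + b * h x\<bar> \<le> \<bar>a\<bar> * C + \<bar>b\<bar> * D" for x
    using abs_triangle_ineq[of "a * f x" "b * h x"] mult_left_mono[OF C[of x], of "\<bar>a\<bar>"]
      mult_left_mono[OF D[of x], of "\<bar>b\<bar>"] by (simp add: abs_mult)
  moreover have "continuous_on UNIV (\<lambda>x. a * f x + b * h x)"
    using assms by (intro continuous_intros) (auto simp: bcont_iff)
  ultimately show ?thesis unfolding bcont_iff by blast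
qed

lemma bcont_translate:
  fixes f :: "'g::topological_group_add \<Rightarrow> real"
  assumes "bcont f"
  shows "bcont (\<lambda>x. f (g + x))"
proof -
  have "continuous_on UNIV (\<lambda>x. f (g + x))"
    by (rule continuous_on_compose2[of UNIV f UNIV "\<lambda>x. g + x"])
      (use assms in \<open>auto simp: bcont_iff intro!: continuous_intros\<close>)
  thus ?thesis using assms by (auto simp: bcont_iff)
qed

lemma mean_on_lincomb:
  "mean_on S m \<Longrightarrow> bcont f \<Longrightarrow> bcont h \<Longrightarrow> m (\<lambda>x. a * f x + b * h x) = a * m f + b * m h"
  unfolding mean_on_def by blast

lemma mean_on_nonneg: "mean_on S m \<Longrightarrow> bcont f \<Longrightarrow> (\<And>x. x \<in> S \<Longrightarrow> f x \<ge> 0) \<Longrightarrow> m f \<ge> 0"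
  unfolding mean_on_def by blast

lemma mean_on_one: "mean_on S m \<Longrightarrow> m (\<lambda>x. 1) = 1"
  unfolding mean_on_def by blast

lemma mean_on_bound:
  assumes m: "mean_on S m" and f: "bcont f" and C: "\<And>x. x \<in> S \<Longrightarrow> \<bar>f x\<bar> \<le> C"
  shows "\<bar>m f\<bar> \<le> C"
proof -
  have "m (\<lambda>x. C * 1 + s * f x) = C + s * m f" for s
    using mean_on_lincomb[OF m bcont_const[of 1] f, of C s] mean_on_one[OF m] by simp
  moreover have "m (\<lambda>x. C * 1 + 1 * f x) \<ge> 0" "m (\<lambda>x. C * 1 + (-1) * f x) \<ge> 0"
    using C by (intro mean_on_nonneg[OF m] bcont_lincomb bcont_const f; force)+
  ultimately have "C + 1 * m f \<ge> 0" "C + (-1) * m f \<ge> 0" by metis+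
  thus ?thesis by simp
qed

lemma mean_on_limit:
  fixes m :: "nat \<Rightarrow> ('g::topological_space \<Rightarrow> real) \<Rightarrow> real"
  assumes m: "\<And>k. mean_on S (m k)"
  obtains L F where "mean_on S L" "F \<noteq> bot" "F \<le> sequentially"
    "\<And>f. bcont f \<Longrightarrow> ((\<lambda>k. m k f) \<longlongrightarrow> L f) F"
proof -
  define B where "B f = (SOME C. \<forall>x. \<bar>f x\<bar> \<le> C)" for f :: "'g \<Rightarrow> real"
  \<comment> \<open>Nothing is known about \<open>m k\<close> off \<open>bcont\<close>, but the
    cluster argument wants a bound at every function; the default 0 provides one.\<close>
  define m' where "m' k f = (if bcont f then m k f else 0)" for k f
  have B: "\<bar>f x\<bar> \<le> B f" if "bcont f" for f x
  proof -
    have "\<exists>C. \<forall>x. \<bar>f x\<bar> \<le> C" using that by (auto simp: bcont_iff)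
    from someI_ex[OF this] show ?thesis by (simp add: B_def)
  qed
  have "\<bar>m' k f\<bar> \<le> (if bcont f then B f else 0)" for k f
    using mean_on_bound[OF m, of f "B f" k] B[of f] by (simp add: m'_def)
  then obtain L F where F: "F \<noteq> bot" "F \<le> sequentially" and L: "\<And>f. ((\<lambda>k. m' k f) \<longlongrightarrow> L f) F"
    using bounded_functionals_cluster[of m' "\<lambda>f. if bcont f then B f else 0"] by metis
  have L': "((\<lambda>k. m k f) \<longlongrightarrow> L f) F" if "bcont f" for f
    using L[of f] that by (simp add: m'_def)
  have "mean_on S L"
    unfolding mean_on_def
  proof (intro conjI allI impI)
    fix f h :: "'g \<Rightarrow> real" and a b :: real
    assume fh: "bcont f" "bcont h"
    have "((\<lambda>k. m k (\<lambda>x. a * f x + b * h x)) \<longlongrightarrow> a * L f + b * L h) F"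
      unfolding mean_on_lincomb[OF m fh] by (intro tendsto_intros L' fh)
    thus "L (\<lambda>x. a * f x + b * h x) = a * L f + b * L h"
      using L'[OF bcont_lincomb[OF fh]] tendsto_unique[OF F(1)] by blast
  next
    fix f :: "'g \<Rightarrow> real" assume f: "bcont f" "\<forall>x\<in>S. 0 \<le> f x"
    show "0 \<le> L f"
      using tendsto_lowerbound[OF L'[OF f(1)] _ F(1), of 0] mean_on_nonneg[OF m f(1)] f(2) by simp
  next
    show "L (\<lambda>x. 1) = 1"
      using L'[OF bcont_const[of 1]] mean_on_one[OF m] tendsto_unique[OF F(1) _ tendsto_const] by simp
  qed
  thus ?thesis using that F L' by blast
qed

lemma right_uniformly_continuous:
  fixes f :: "'g::topological_group_add \<Rightarrow> real"
  assumes H: "compact H" and f: "continuous_on UNIV f" and e: "e > 0"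
  obtains V where "open V" "0 \<in> V" "\<And>x v. x \<in> H \<Longrightarrow> v \<in> V \<Longrightarrow> \<bar>f (x + v) - f x\<bar> \<le> e"
proof -
  have "continuous_on (UNIV \<times> H) (\<lambda>z::'g\<times>'g. f (snd z + fst z))"
    by (intro continuous_on_compose2[OF f] continuous_intros) auto
  thus ?thesis
  proof (rule continuous_on_prod_compactE[OF _ H UNIV_I[of 0] e])
    fix V :: "'g set"
    assume V: "0 \<in> V" "open V"
      "\<forall>v\<in>V \<inter> UNIV. \<forall>x\<in>H. dist (f (snd (v, x) + fst (v, x))) (f (snd (0, x) + fst (0, x))) \<le> e"
    show thesis
      by (rule that[OF V(2,1)]) (use V(3) in \<open>simp add: dist_real_def\<close>)
  qed
qed

text \<open>This replaces Haar measure on H. With \<open>U i\<close> shrinking to 0, average f over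
  representatives of \<open>H / U i\<close>. Left translation by h permutes the cosets and moves
  each representative only by an element of \<open>U i\<close> on the right, so by uniform
  continuity on H the average changes by an amount tending to 0. A cluster point of the averages is
  exactly invariant.\<close>

lemma compact_subgroup_invariant_mean:
  fixes H :: "'g::{topological_group_add, t2_space, first_countable_topology} set"
  assumes lc: "locally compact (UNIV :: 'g set)" and td: "totally_disconnected TYPE('g)"
    and H: "open_subgroup H" "compact H"
  obtains M where "mean_on H M" "\<And>f h. bcont f \<Longrightarrow> h \<in> H \<Longrightarrow> M (\<lambda>x. f (h + x)) = M f"
proof -
  obtain A :: "nat \<Rightarrow> 'g set" where A: "\<And>i. open (A i)" "\<And>i. 0 \<in> A i"
    and Ae: "\<And>S. open S \<Longrightarrow> 0 \<in> S \<Longrightarrow> eventually (\<lambda>i. A i \<subseteq> S) sequentially"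
    using countable_basis_at_decseq[of 0] by blast
  have "\<exists>U. open_subgroup U \<and> U \<subseteq> A i \<inter> H" for i
    using van_Dantzig[OF lc td, of "A i \<inter> H"] A[of i] H(1) unfolding open_subgroup_def
    by (metis Int_iff open_Int)
  then obtain U where U: "\<And>i. open_subgroup (U i)" "\<And>i. U i \<subseteq> A i" "\<And>i. U i \<subseteq> H" by (metis Int_subset_iff)
  have "\<exists>T \<rho>. finite T \<and> T \<noteq> {} \<and> T \<subseteq> H \<and> (\<forall>x\<in>H. \<rho> x \<in> T \<and> - \<rho> x + x \<in> U i) \<and>
         (\<forall>h\<in>H. bij_betw (\<lambda>t. \<rho> (h + t)) T T)" for i
    using finite_transversal[OF H U(1,3), of i] by metis
  then obtain T \<rho> where T: "\<And>i. finite (T i)" "\<And>i. T i \<noteq> {}" "\<And>i. T i \<subseteq> H"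
    and \<rho>: "\<And>i x. x \<in> H \<Longrightarrow> \<rho> i x \<in> T i \<and> - \<rho> i x + x \<in> U i"
    and bij: "\<And>i h. h \<in> H \<Longrightarrow> bij_betw (\<lambda>t. \<rho> i (h + t)) (T i) (T i)" by metis
  define m where "m i f = (\<Sum>t\<in>T i. f t) / card (T i)" for i and f :: "'g \<Rightarrow> real"
  have card: "real (card (T i)) > 0" for i using T by (simp add: card_gt_0_iff)
  have "mean_on H (m i)" for i
    unfolding mean_on_def
  proof (intro conjI allI impI)
    show "m i (\<lambda>x. a * f x + b * h x) = a * m i f + b * m i h" for a b f h
      by (simp add: m_def sum.distrib sum_distrib_left add_divide_distrib)
    show "0 \<le> m i f" if "\<forall>x\<in>H. 0 \<le> f x" for f
      using that T(3)[of i] by (auto simp: m_def intro!: divide_nonneg_nonneg sum_nonneg)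
    show "m i (\<lambda>x. 1) = 1" using card[of i] by (simp add: m_def)
  qed
  then obtain L F where L: "mean_on H L" and F: "F \<noteq> bot" "F \<le> sequentially"
    and lim: "\<And>f. bcont f \<Longrightarrow> ((\<lambda>k. m k f) \<longlongrightarrow> L f) F"
    using mean_on_limit[of H m] by blast
  have "L (\<lambda>x. f (h + x)) = L f" if f: "bcont f" and h: "h \<in> H" for f h
  proof -
    have "(\<lambda>i. m i (\<lambda>x. f (h + x)) - m i f) \<longlonglongrightarrow> 0"
    proof (rule tendstoI)
      fix e :: real assume e: "e > 0"
      obtain V where V: "open V" "0 \<in> V" "\<And>x v. x \<in> H \<Longrightarrow> v \<in> V \<Longrightarrow> \<bar>f (x + v) - f x\<bar> \<le> e / 2"
        using right_uniformly_continuous[OF H(2), of f "e/2"] f e by (auto simp: bcont_iff)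
      show "eventually (\<lambda>i. dist (m i (\<lambda>x. f (h + x)) - m i f) 0 < e) sequentially"
        using Ae[OF V(1,2)]
      proof eventually_elim
        case (elim i)
        \<comment> \<open>After this reindexing the two averages are compared at
          \<open>h + t\<close> and \<open>\<rho> i (h + t)\<close>, which lie in the same coset of
          \<open>U i\<close>.\<close>
        have "(\<Sum>t\<in>T i. f t) = (\<Sum>t\<in>T i. f (\<rho> i (h + t)))"
          by (rule sum.reindex_bij_betw[OF bij[OF h], symmetric])
        hence "m i (\<lambda>x. f (h + x)) - m i f = (\<Sum>t\<in>T i. f (h + t) - f (\<rho> i (h + t))) / card (T i)"
          by (simp add: m_def sum_subtractf diff_divide_distrib)
        also have "\<bar>\<dots>\<bar> \<le> (\<Sum>t\<in>T i. e / 2) / card (T i)"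
        proof -
          have "\<bar>f (h + t) - f (\<rho> i (h + t))\<bar> \<le> e / 2" if "t \<in> T i" for t
          proof -
            have ht: "h + t \<in> H" using h that T(3) H(1) by (auto simp: open_subgroup_def)
            have "- \<rho> i (h + t) + (h + t) \<in> V" "\<rho> i (h + t) \<in> H"
              using \<rho>[OF ht, of i] U(2)[of i] elim T(3)[of i] by blast+
            from V(3)[OF this(2,1)] show ?thesis by (simp add: add.assoc[symmetric])
          qed
          hence "\<bar>\<Sum>t\<in>T i. f (h + t) - f (\<rho> i (h + t))\<bar> \<le> (\<Sum>t\<in>T i. e / 2)"
            by (intro order_trans[OF sum_abs] sum_mono)
          hence "\<bar>\<Sum>t\<in>T i. f (h + t) - f (\<rho> i (h + t))\<bar> / card (T i) \<le> (\<Sum>t\<in>T i. e / 2) / card (T i)"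
            by (rule divide_right_mono) simp
          thus ?thesis by (simp only: abs_divide abs_of_nat)
        qed
        also have "\<dots> < e" using card[of i] e by simp
        finally show ?case by simp
      qed
    qed
    hence "((\<lambda>i. m i (\<lambda>x. f (h + x)) - m i f) \<longlongrightarrow> 0) F"
      using F(2) tendsto_mono by blast
    moreover have "((\<lambda>i. m i (\<lambda>x. f (h + x)) - m i f) \<longlongrightarrow> L (\<lambda>x. f (h + x)) - L f) F"
      by (intro tendsto_diff lim bcont_translate f)
    ultimately show ?thesis using tendsto_unique[OF F(1)] by fastforce
  qed
  thus ?thesis using that L by blast
qed

lemma amenableI:
  fixes m :: "('g::topological_group_add \<Rightarrow> real) \<Rightarrow> real"
  assumes "mean_on UNIV m" "\<And>f g. bcont f \<Longrightarrow> m (\<lambda>x. f (g + x)) = m f"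
  shows "amenable TYPE('g)"
  unfolding amenable_def
proof (intro exI[of _ m] conjI allI impI)
  show "m (\<lambda>x. a * f x + b * h x) = a * m f + b * m h" if "bcont f" "bcont h" for f h a b
    by (rule mean_on_lincomb[OF assms(1) that])
  show "0 \<le> m f" if "bcont f" "\<forall>x. 0 \<le> f x" for f
    using that(2) by (intro mean_on_nonneg[OF assms(1) that(1)]) simp
  show "m (\<lambda>x. 1) = 1" by (rule mean_on_one[OF assms(1)])
qed (rule assms(2))

text \<open>Used contrapositively: non-amenability makes G non-compact, and only then does vanishing
  at infinity carry information.\<close>

lemma compact_imp_amenable:
  assumes "locally compact (UNIV :: 'g set)" "totally_disconnected TYPE('g)"
    and "compact (UNIV :: 'g::{topological_group_add, t2_space, first_countable_topology} set)"
  shows "amenable TYPE('g)"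
proof -
  have "open_subgroup (UNIV :: 'g set)" by (simp add: open_subgroup_def)
  from compact_subgroup_invariant_mean[OF assms(1,2) this assms(3)] show ?thesis
    using amenableI by (metis UNIV_I)
qed

lemma summable_norm_reindex_bij:
  fixes f :: "nat \<Rightarrow> 'a::banach"
  assumes "bij \<sigma>" "summable (\<lambda>n. norm (f n))"
  shows "summable (\<lambda>n. norm (f (\<sigma> n)))" "(\<Sum>n. f (\<sigma> n)) = (\<Sum>n. f n)"
proof -
  have "(\<lambda>n. norm (f n)) summable_on UNIV"
    using assms(2) by (simp add: summable_on_UNIV_nonneg_real_iff)
  hence "(\<lambda>n. norm (f (\<sigma> n))) summable_on UNIV"
    using summable_on_reindex_bij_betw[of \<sigma> UNIV UNIV "\<lambda>n. norm (f n)"] assms(1) by simp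
  thus *: "summable (\<lambda>n. norm (f (\<sigma> n)))"
    by (simp add: summable_on_UNIV_nonneg_real_iff)
  have "(f has_sum (\<Sum>n. f n)) UNIV"
    by (rule norm_summable_imp_has_sum[OF assms(2) summable_sums[OF summable_norm_cancel[OF assms(2)]]])
  moreover have "((\<lambda>n. f (\<sigma> n)) has_sum (\<Sum>n. f (\<sigma> n))) UNIV"
    by (rule norm_summable_imp_has_sum[OF * summable_sums[OF summable_norm_cancel[OF *]]])
  ultimately show "(\<Sum>n. f (\<sigma> n)) = (\<Sum>n. f n)"
    using has_sum_reindex_bij_betw[of \<sigma> UNIV UNIV f "\<Sum>n. f n"] assms(1) has_sum_unique by metis
qed

section \<open>Group actions on the natural numbers\<close>

text \<open>Open stabilisers express continuity of the action on the discrete set of natural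
  numbers.\<close>

locale nat_action =
  fixes act :: "'g::topological_group_add \<Rightarrow> nat \<Rightarrow> nat"
  assumes act_zero [simp]: "act 0 n = n"
    and act_add: "act (g + h) n = act g (act h n)"
    and open_stab: "open {g. act g n = n}"
begin

definition stab :: "nat \<Rightarrow> 'g set" where "stab n = {g. act g n = n}"

lemma act_minus [simp]: "act (- g) (act g n) = n" "act g (act (- g) n) = n"
  by (simp_all flip: act_add)

lemma act_eq_iff [simp]: "act g m = act g n \<longleftrightarrow> m = n"
  by (metis act_minus(1))

lemma bij_act: "bij (act g)"
  by (rule o_bij[of "act (- g)"]) (auto simp: fun_eq_iff)

lemma open_subgroup_stab: "open_subgroup (stab n)"
proof -
  have "act (- g) n = n" if "act g n = n" for g by (metis act_minus(1) that)
  thus ?thesis using open_stab by (simp add: open_subgroup_def stab_def act_add)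
qed

lemma open_act_eq: "open {g. act g n = m}"
proof (cases "\<exists>a. act a n = m")
  case True
  then obtain a where a: "act a n = m" by blast
  have "act (- a) m = n" using a by auto
  hence "act g n = m \<longleftrightarrow> - a + g \<in> {g. act g n = n}" for g
    using act_eq_iff[of "- a" "act g n" m] by (simp only: mem_Collect_eq act_add)
  hence "{g. act g n = m} = {g. - a + g \<in> {g. act g n = n}}"
    by (rule Collect_cong)
  thus ?thesis using open_translate[OF open_stab[of n], of "- a"] by metis
qed simp

end

text \<open>On the orbit of \<open>r\<close> the fibre of the orbit map over \<open>act t r\<close> is the coset \<open>t + stab r\<close>;
  the invariant mean of the compact group \<open>stab r\<close> averages a function over it, independently
  of the choice of \<open>t\<close>.\<close>
lemma (in nat_action) orbit_average:
  fixes X :: "nat set"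
  assumes inv: "\<And>g n. n \<in> X \<Longrightarrow> act g n \<in> X"
    and M: "\<And>n. n \<in> X \<Longrightarrow> \<exists>M. mean_on (stab n) M \<and>
              (\<forall>f h. bcont f \<longrightarrow> h \<in> stab n \<longrightarrow> M (\<lambda>x. f (h + x)) = M f)"
  obtains avg where "\<And>n. n \<in> X \<Longrightarrow> mean_on UNIV (\<lambda>f. avg f n)"
    "\<And>f g n. bcont f \<Longrightarrow> n \<in> X \<Longrightarrow> avg (\<lambda>x. f (g + x)) n = avg f (act g n)"
proof -
  obtain M where M1: "\<And>n. n \<in> X \<Longrightarrow> mean_on (stab n) (M n)"
    and M2: "\<And>n f h. n \<in> X \<Longrightarrow> bcont f \<Longrightarrow> h \<in> stab n \<Longrightarrow> M n (\<lambda>x. f (h + x)) = M n f"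
    using M by metis
  \<comment> \<open>The least element serves as base point because it depends on the orbit
    alone.\<close>
  define r where "r n = (LEAST m. \<exists>g. act g m = n)" for n
  define t where "t n = (SOME g. act g (r n) = n)" for n
  define avg where "avg f n = M (r n) (\<lambda>h. f (t n + h))" for f n
  have "\<exists>g. act g (r n) = n" for n
    unfolding r_def by (rule LeastI[of _ n]) (metis act_zero)
  hence t: "act (t n) (r n) = n" for n unfolding t_def by (rule someI_ex)
  have r_act: "r (act g n) = r n" for g n
  proof -
    have "(\<exists>h. act h m = act g n) \<longleftrightarrow> (\<exists>h. act h m = n)" for m
      by (metis act_add act_minus(1))
    thus ?thesis by (simp add: r_def)
  qed
  have rX: "r n \<in> X" if "n \<in> X" for n
    using inv[OF that, of "- t n"] t[of n] by (metis act_minus(1))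
  have "mean_on UNIV (\<lambda>f. avg f n)" if n: "n \<in> X" for n
    unfolding mean_on_def avg_def
  proof (intro conjI allI impI)
    note Mn = M1[OF rX[OF n]]
    show "M (r n) (\<lambda>h. a * f (t n + h) + b * h' (t n + h)) =
        a * M (r n) (\<lambda>h. f (t n + h)) + b * M (r n) (\<lambda>h. h' (t n + h))" if "bcont f" "bcont h'" for f h' a b
      by (rule mean_on_lincomb[OF Mn that[THEN bcont_translate]])
    show "0 \<le> M (r n) (\<lambda>h. f (t n + h))" if "bcont f" "\<forall>x\<in>UNIV. 0 \<le> f x" for f
      using that(2) by (intro mean_on_nonneg[OF Mn bcont_translate[OF that(1)]]) simp
    show "M (r n) (\<lambda>h. 1) = 1" by (rule mean_on_one[OF Mn])
  qed
  moreover have "avg (\<lambda>x. f (g + x)) n = avg f (act g n)" if f: "bcont f" and n: "n \<in> X" for f g n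
  proof -
    \<comment> \<open>Both \<open>g + t n\<close> and \<open>t (act g n)\<close> carry the base
      point to \<open>act g n\<close>; they differ by the element h of its stabiliser, which the
      mean does not see.\<close>
    define h where "h = - t (act g n) + (g + t n)"
    have "act h (r n) = act (- t (act g n)) (act g n)" by (simp add: h_def act_add t)
    also have "\<dots> = r n" using t[of "act g n"] by (metis act_minus(1) r_act)
    finally have h: "h \<in> stab (r n)" by (simp add: stab_def)
    have "g + (t n + x) = t (act g n) + (h + x)" for x
      by (simp add: h_def add.assoc[symmetric])
    hence "avg (\<lambda>x. f (g + x)) n = M (r n) (\<lambda>x. (\<lambda>y. f (t (act g n) + y)) (h + x))"
      by (simp add: avg_def)
    also have "\<dots> = avg f (act g n)"
      unfolding avg_def r_act by (rule M2[OF rX[OF n] bcont_translate[OF f] h])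
    finally show ?thesis .
  qed
  ultimately show ?thesis using that by blast
qed

text \<open>Integrating the orbit averages of f against \<open>\<mu> k\<close> gives a mean on G. By
  equivariance of the averages, translating f amounts to moving \<open>\<mu> k\<close>, which costs
  at most the sup of the averages times an \<open>l\<^sub>1\<close> distance tending to 0. A cluster
  point of these means is invariant.\<close>

lemma (in nat_action) amenable_if_almost_invariant:
  fixes X :: "nat set" and \<mu> :: "nat \<Rightarrow> nat \<Rightarrow> real"
  assumes inv: "\<And>g n. n \<in> X \<Longrightarrow> act g n \<in> X"
    and M: "\<And>n. n \<in> X \<Longrightarrow> \<exists>M. mean_on (stab n) M \<and>
              (\<forall>f h. bcont f \<longrightarrow> h \<in> stab n \<longrightarrow> M (\<lambda>x. f (h + x)) = M f)"
    and nonneg: "\<And>k n. \<mu> k n \<ge> 0" and sums: "\<And>k. \<mu> k sums 1" and supp: "\<And>k n. n \<notin> X \<Longrightarrow> \<mu> k n = 0"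
    and lim: "\<And>g. (\<lambda>k. \<Sum>n. \<bar>\<mu> k (act g n) - \<mu> k n\<bar>) \<longlonglongrightarrow> 0"
  shows "amenable TYPE('g)"
proof -
  obtain avg where avg: "\<And>n. n \<in> X \<Longrightarrow> mean_on UNIV (\<lambda>f. avg f n)"
    and avg_act: "\<And>f g n. bcont f \<Longrightarrow> n \<in> X \<Longrightarrow> avg (\<lambda>x. f (g + x)) n = avg f (act g n)"
    using orbit_average[OF inv M] by metis
  have bd: "\<exists>C\<ge>0. \<forall>n\<in>X. \<bar>avg f n\<bar> \<le> C" if f: "bcont f" for f
  proof -
    obtain C where C: "\<And>x. \<bar>f x\<bar> \<le> C" using f by (auto simp: bcont_iff)
    moreover have "0 \<le> C" using C[of 0] by simp
    ultimately show ?thesis using mean_on_bound[OF avg f] by metis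
  qed
  have summ: "summable (\<lambda>n. norm (\<mu> k n * avg f n))" if f: "bcont f" for k f
  proof -
    obtain C where C: "C \<ge> 0" "\<And>n. n \<in> X \<Longrightarrow> \<bar>avg f n\<bar> \<le> C" using bd[OF f] by blast
    have "norm (norm (\<mu> k n * avg f n)) \<le> \<mu> k n * C" for n
      using nonneg[of k n] C supp by (cases "n \<in> X") (auto simp: abs_mult intro: mult_left_mono)
    moreover have "summable (\<lambda>n. \<mu> k n * C)" using sums[of k] by (intro summable_mult2) (rule sums_summable)
    ultimately show ?thesis by (rule summable_comparison_test'[rotated])
  qed
  define m where "m k f = (\<Sum>n. \<mu> k n * avg f n)" for k f
  have "mean_on UNIV (m k)" for k
    unfolding mean_on_def
  proof (intro conjI allI impI)
    fix f h :: "'g \<Rightarrow> real" and a b :: real assume fh: "bcont f" "bcont h"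
    have "\<mu> k n * avg (\<lambda>x. a * f x + b * h x) n = a * (\<mu> k n * avg f n) + b * (\<mu> k n * avg h n)" for n
      using mean_on_lincomb[OF avg fh] supp by (cases "n \<in> X") (auto simp: algebra_simps)
    thus "m k (\<lambda>x. a * f x + b * h x) = a * m k f + b * m k h"
      using summable_norm_cancel[OF summ[OF fh(1), of k]] summable_norm_cancel[OF summ[OF fh(2), of k]]
      by (simp add: m_def summable_mult suminf_mult[symmetric] suminf_add)
  next
    fix f :: "'g \<Rightarrow> real" assume f: "bcont f" "\<forall>x\<in>UNIV. 0 \<le> f x"
    have "0 \<le> \<mu> k n * avg f n" for n
      using mean_on_nonneg[OF avg f(1)] f(2) nonneg supp by (cases "n \<in> X") auto
    thus "0 \<le> m k f"
      unfolding m_def using summable_norm_cancel[OF summ[OF f(1), of k]] by (rule suminf_nonneg[rotated])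
  next
    have "\<mu> k n * avg (\<lambda>x. 1) n = \<mu> k n" for n
      using mean_on_one[OF avg] supp by (cases "n \<in> X") auto
    thus "m k (\<lambda>x. 1) = 1" using sums_unique[OF sums[of k]] by (simp only: m_def)
  qed
  then obtain L F where L: "mean_on UNIV L" and F: "F \<noteq> bot" "F \<le> sequentially"
    and limL: "\<And>f. bcont f \<Longrightarrow> ((\<lambda>k. m k f) \<longlongrightarrow> L f) F"
    using mean_on_limit[of UNIV m] by blast
  have "L (\<lambda>x. f (g + x)) = L f" if f: "bcont f" for f g
  proof -
    obtain C where C: "C \<ge> 0" "\<And>n. n \<in> X \<Longrightarrow> \<bar>avg f n\<bar> \<le> C" using bd[OF f] by blast
    let ?d = "\<lambda>k n. \<bar>\<mu> k (act (- g) n) - \<mu> k n\<bar>"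
    have "norm (m k (\<lambda>x. f (g + x)) - m k f) \<le> C * (\<Sum>n. ?d k n)" for k
    proof -
      \<comment> \<open>Off X nothing is known about \<open>avg\<close>, but there both sides carry
        the factor \<open>\<mu> k n = 0\<close>.\<close>
      have e: "\<mu> k n * avg (\<lambda>x. f (g + x)) n = \<mu> k (act (- g) (act g n)) * avg f (act g n)" for n
        using avg_act[OF f] supp by (cases "n \<in> X") auto
      let ?h = "\<lambda>n. \<mu> k (act (- g) n) * avg f n"
      have "summable (\<lambda>n. norm (?h (act g n)))"
        using summ[OF bcont_translate[OF f], of k g] unfolding e .
      from summable_norm_reindex_bij(1)[OF bij_act[of "- g"] this]
      have sh: "summable (\<lambda>n. norm (?h n))" by simp
      have "m k (\<lambda>x. f (g + x)) = (\<Sum>n. ?h n)"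
        unfolding m_def e by (rule summable_norm_reindex_bij(2)[OF bij_act sh])
      moreover have sd: "summable (?d k)"
      proof -
        have s\<mu>: "summable (\<lambda>n. norm (\<mu> k n))" using sums[of k] nonneg by (simp add: sums_iff)
        have "summable (\<lambda>n. norm (\<mu> k (act (- g) n)))"
          using summable_norm_reindex_bij(1)[OF bij_act s\<mu>] .
        hence "summable (\<lambda>n. norm (\<mu> k (act (- g) n)) + norm (\<mu> k n))" using s\<mu> by (rule summable_add)
        thus ?thesis
          by (rule summable_comparison_test'[where N=0]) (simp add: abs_triangle_ineq4)
      qed
      ultimately have "m k (\<lambda>x. f (g + x)) - m k f = (\<Sum>n. ?h n - \<mu> k n * avg f n)"
        unfolding m_def using summable_norm_cancel[OF sh] summable_norm_cancel[OF summ[OF f, of k]]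
        by (simp add: suminf_diff)
      also have "norm \<dots> \<le> (\<Sum>n. C * ?d k n)"
      proof (rule order_trans[OF summable_norm suminf_le])
        show le: "norm (?h n - \<mu> k n * avg f n) \<le> C * ?d k n" for n
        proof -
          have "?h n - \<mu> k n * avg f n = (\<mu> k (act (- g) n) - \<mu> k n) * avg f n" by (simp add: algebra_simps)
          moreover have "act (- g) n \<notin> X" if "n \<notin> X" using inv[of "act (- g) n" g] that by auto
          ultimately show ?thesis
            using C supp by (cases "n \<in> X") (auto simp: abs_mult mult.commute intro!: mult_right_mono)
        qed
        show "summable (\<lambda>n. C * ?d k n)" using sd by (rule summable_mult)
        thus "summable (\<lambda>n. norm (?h n - \<mu> k n * avg f n))"
          by (rule summable_comparison_test'[where N=0]) (use le in simp)
        thus "summable (\<lambda>n. norm (?h n - \<mu> k n * avg f n))" .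
      qed
      also have "\<dots> = C * (\<Sum>n. ?d k n)" by (rule suminf_mult[OF sd])
      finally show ?thesis .
    qed
    hence le: "eventually (\<lambda>k. norm (m k (\<lambda>x. f (g + x)) - m k f) \<le> C * (\<Sum>n. ?d k n)) sequentially"
      by simp
    have "(\<lambda>k. C * (\<Sum>n. ?d k n)) \<longlonglongrightarrow> 0"
      using tendsto_mult_right_zero[OF lim[of "- g"], of C] .
    hence "(\<lambda>k. m k (\<lambda>x. f (g + x)) - m k f) \<longlonglongrightarrow> 0"
      by (rule Lim_null_comparison[OF le])
    hence "((\<lambda>k. m k (\<lambda>x. f (g + x)) - m k f) \<longlongrightarrow> 0) F"
      using F(2) tendsto_mono by blast
    moreover have "((\<lambda>k. m k (\<lambda>x. f (g + x)) - m k f) \<longlongrightarrow> L (\<lambda>x. f (g + x)) - L f) F"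
      by (intro tendsto_diff limL bcont_translate f)
    ultimately show ?thesis using tendsto_unique[OF F(1)] by fastforce
  qed
  thus ?thesis using amenableI[OF L] by blast
qed

section \<open>Isometries of l_p\<close>

lemma powr_add_superadditive:
  fixes A B r :: real
  assumes "A > 0" "B > 0" "r > 1"
  shows "A powr r + B powr r < (A + B) powr r"
proof -
  have "A powr r = A * A powr (r - 1)" "B powr r = B * B powr (r - 1)"
    using assms by (simp_all add: powr_diff)
  moreover have "A * A powr (r - 1) < A * (A + B) powr (r - 1)" "B * B powr (r - 1) < B * (A + B) powr (r - 1)"
    using assms by (auto intro!: powr_less_mono2)
  moreover have "(A + B) powr r = (A + B) * (A + B) powr (r - 1)"
    using assms by (simp add: powr_diff)
  hence "(A + B) powr r = A * (A + B) powr (r - 1) + B * (A + B) powr (r - 1)"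
    by (simp only: distrib_right)
  ultimately show ?thesis by linarith
qed

lemma powr_add_subadditive:
  fixes A B r :: real
  assumes "A > 0" "B > 0" "r < 1"
  shows "(A + B) powr r < A powr r + B powr r"
proof -
  have "A powr r = A * A powr (r - 1)" "B powr r = B * B powr (r - 1)"
    using assms by (simp_all add: powr_diff)
  moreover have "A * (A + B) powr (r - 1) < A * A powr (r - 1)" "B * (A + B) powr (r - 1) < B * B powr (r - 1)"
    using assms by (auto intro!: powr_less_mono2_neg)
  moreover have "(A + B) powr r = (A + B) * (A + B) powr (r - 1)"
    using assms by (simp add: powr_diff)
  hence "(A + B) powr r = A * (A + B) powr (r - 1) + B * (A + B) powr (r - 1)"
    by (simp only: distrib_right)
  ultimately show ?thesis by linarith
qed

lemma powr_midpoint_convex: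
  fixes s t r :: real
  assumes "s \<ge> 0" "t \<ge> 0" "r \<ge> 1"
  shows "2 * ((s + t) / 2) powr r \<le> s powr r + t powr r"
proof -
  have half: "2 * (x / 2) powr r \<le> x powr r" if "x \<ge> 0" for x
  proof -
    have "(2::real) powr 1 \<le> 2 powr r" using assms(3) by (intro powr_mono) auto
    hence "2 / 2 powr r \<le> (1::real)" by (simp add: divide_simps)
    hence "2 / 2 powr r * x powr r \<le> 1 * x powr r" by (intro mult_right_mono) auto
    thus ?thesis using that by (simp add: powr_divide)
  qed
  consider "s = 0" | "t = 0" | "s > 0" "t > 0" using assms by linarith
  thus ?thesis
  proof cases
    case 3
    have "((1 - 1/2) *\<^sub>R s + (1/2) *\<^sub>R t) powr r \<le> (1 - 1/2) * s powr r + (1/2) * t powr r"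
      by (rule convex_onD[OF powr_convex[OF assms(3)]]) (use 3 in auto)
    thus ?thesis by (simp add: add_divide_distrib)
  qed (use half assms in auto)
qed

lemma powr_midpoint_concave:
  fixes s t r :: real
  assumes "s \<ge> 0" "t \<ge> 0" "0 < r" "r \<le> 1"
  shows "s powr r + t powr r \<le> 2 * ((s + t) / 2) powr r"
proof -
  \<comment> \<open>Concavity for exponent r is convexity for exponent \<open>1 / r\<close>, applied
    to the r-th powers.\<close>
  let ?u = "s powr r" and ?v = "t powr r"
  have "2 * ((?u + ?v) / 2) powr (1 / r) \<le> s + t"
    using powr_midpoint_convex[of ?u ?v "1 / r"] assms by (simp add: powr_powr)
  hence "((?u + ?v) / 2) powr (1 / r) \<le> (s + t) / 2" by simp
  hence "(((?u + ?v) / 2) powr (1 / r)) powr r \<le> ((s + t) / 2) powr r"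
    using assms by (intro powr_mono2) auto
  thus ?thesis using assms by (simp add: powr_powr)
qed

text \<open>The deviation from the parallelogram law at exponent p. For positive
  \<open>p \<noteq> 2\<close> it has one fixed strict sign unless \<open>a * b = 0\<close>, so a
  vanishing sum of defects forces every term to vanish.\<close>

definition clarkson_defect :: "real \<Rightarrow> complex \<Rightarrow> complex \<Rightarrow> real" where
  "clarkson_defect p a b =
     norm (a + b) powr p + norm (a - b) powr p - 2 * (norm a powr p + norm b powr p)"

lemma clarkson_defect_eq_0: "a * b = 0 \<Longrightarrow> clarkson_defect p a b = 0"
  by (auto simp: clarkson_defect_def)

lemma norm_powr_conv_square: "norm (z::complex) powr p = ((norm z)\<^sup>2) powr (p / 2)"
proof -
  have "((norm z)\<^sup>2) powr (p / 2) = (norm z powr 2) powr (p / 2)" by simp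
  thus ?thesis by (simp only: powr_powr) simp
qed

lemma parallelogram_complex: "(norm (a + b))\<^sup>2 + (norm (a - b))\<^sup>2 = 2 * ((norm a)\<^sup>2 + (norm (b::complex))\<^sup>2)"
  by (simp add: cmod_power2) (simp add: power2_eq_square algebra_simps)

text \<open>Write p-th powers of moduli as powers \<open>p / 2 > 1\<close> of squares. The
  parallelogram law fixes the mean of the two squares on the left; convexity bounds their powers
  below by those of the mean, and strict superadditivity splits the result. Below exponent 2 both
  inequalities reverse.\<close>

lemma clarkson_defect_pos:
  assumes "p > 2" "a * b \<noteq> 0"
  shows "clarkson_defect p a b > 0"
proof -
  let ?A = "(norm a)\<^sup>2" and ?B = "(norm b)\<^sup>2"
  have e: "((norm (a + b))\<^sup>2 + (norm (a - b))\<^sup>2) / 2 = ?A + ?B"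
    using parallelogram_complex[of a b] by simp
  have "2 * (?A + ?B) powr (p/2) \<le> norm (a + b) powr p + norm (a - b) powr p"
    using powr_midpoint_convex[of "(norm (a + b))\<^sup>2" "(norm (a - b))\<^sup>2" "p/2"] assms
    unfolding norm_powr_conv_square[of "a + b" p] norm_powr_conv_square[of "a - b" p] e
    by simp
  moreover have "2 * (?A powr (p/2) + ?B powr (p/2)) < 2 * (?A + ?B) powr (p/2)"
    using assms powr_add_superadditive[of ?A ?B "p/2"] by simp
  ultimately have "2 * (?A powr (p/2) + ?B powr (p/2)) < norm (a + b) powr p + norm (a - b) powr p"
    by (rule less_le_trans[rotated])
  thus ?thesis
    unfolding clarkson_defect_def norm_powr_conv_square[of a p] norm_powr_conv_square[of b p] by simp
qed

lemma clarkson_defect_neg: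
  assumes "0 < p" "p < 2" "a * b \<noteq> 0"
  shows "clarkson_defect p a b < 0"
proof -
  let ?A = "(norm a)\<^sup>2" and ?B = "(norm b)\<^sup>2"
  have e: "((norm (a + b))\<^sup>2 + (norm (a - b))\<^sup>2) / 2 = ?A + ?B"
    using parallelogram_complex[of a b] by simp
  have "norm (a + b) powr p + norm (a - b) powr p \<le> 2 * (?A + ?B) powr (p/2)"
    using powr_midpoint_concave[of "(norm (a + b))\<^sup>2" "(norm (a - b))\<^sup>2" "p/2"] assms
    unfolding norm_powr_conv_square[of "a + b" p] norm_powr_conv_square[of "a - b" p] e
    by simp
  moreover have "2 * (?A + ?B) powr (p/2) < 2 * (?A powr (p/2) + ?B powr (p/2))"
    using assms powr_add_subadditive[of ?A ?B "p/2"] by simp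
  ultimately have "norm (a + b) powr p + norm (a - b) powr p < 2 * (?A powr (p/2) + ?B powr (p/2))"
    by (rule le_less_trans)
  thus ?thesis
    unfolding clarkson_defect_def norm_powr_conv_square[of a p] norm_powr_conv_square[of b p] by simp
qed

lemma norm_lincomb_powr_le:
  fixes z w :: complex
  assumes "p > 0"
  shows "norm (a * z + b * w) powr p
    \<le> (2 * norm a) powr p * norm z powr p + (2 * norm b) powr p * norm w powr p"
proof -
  have "norm (a * z + b * w) \<le> 2 * norm a * norm z \<or> norm (a * z + b * w) \<le> 2 * norm b * norm w"
    using norm_triangle_ineq[of "a * z" "b * w"] by (auto simp: norm_mult)
  thus ?thesis
  proof
    assume "norm (a * z + b * w) \<le> 2 * norm a * norm z"
    hence "norm (a * z + b * w) powr p \<le> (2 * norm a * norm z) powr p" using assms by (intro powr_mono2) auto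
    thus ?thesis by (simp add: powr_mult add_increasing2)
  next
    assume "norm (a * z + b * w) \<le> 2 * norm b * norm w"
    hence "norm (a * z + b * w) powr p \<le> (2 * norm b * norm w) powr p" using assms by (intro powr_mono2) auto
    thus ?thesis by (simp add: powr_mult add_increasing)
  qed
qed

section \<open>Vectors in l_p and the Banach-Lamperti theorem\<close>

lemma lp_lincomb:
  assumes "p > 0" "f \<in> lp p" "h \<in> lp p"
  shows "(\<lambda>n. a * f n + b * h n) \<in> lp p"
proof -
  have "summable (\<lambda>n. (2 * norm a) powr p * norm (f n) powr p + (2 * norm b) powr p * norm (h n) powr p)"
    using assms by (intro summable_add summable_mult) (auto simp: lp_def)
  hence "summable (\<lambda>n. norm (a * f n + b * h n) powr p)"
    by (rule summable_comparison_test'[where N=0]) (simp add: norm_lincomb_powr_le[OF assms(1)])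
  thus ?thesis by (simp add: lp_def)
qed

lemma lp_add: "p > 0 \<Longrightarrow> f \<in> lp p \<Longrightarrow> h \<in> lp p \<Longrightarrow> (\<lambda>n. f n + h n) \<in> lp p"
  and lp_diff: "p > 0 \<Longrightarrow> f \<in> lp p \<Longrightarrow> h \<in> lp p \<Longrightarrow> (\<lambda>n. f n - h n) \<in> lp p"
  using lp_lincomb[of p f h 1 1] lp_lincomb[of p f h 1 "-1"] by simp_all

lemma lp_restrict: "f \<in> lp p \<Longrightarrow> (\<lambda>n. if P n then f n else 0) \<in> lp p"
  unfolding lp_def by (auto intro: summable_comparison_test'[where N=0])

definition unit_vec :: "nat \<Rightarrow> nat \<Rightarrow> complex" where
  "unit_vec n m = (if m = n then 1 else 0)"

lemma unit_vec_simps [simp]: "unit_vec n n = 1" "m \<noteq> n \<Longrightarrow> unit_vec n m = 0"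
  by (auto simp: unit_vec_def)

lemma unit_vec_powr: "norm (unit_vec n m) powr p = (if m = n then 1 else 0)"
  by (auto simp: unit_vec_def)

lemma unit_vec_in_lp [simp]: "unit_vec n \<in> lp p"
  unfolding lp_def by (auto simp: unit_vec_powr intro: summable_finite[of "{n}"])

lemma zero_in_lp [simp]: "(\<lambda>n. 0) \<in> lp p"
  by (simp add: lp_def)

lemma suminf_single:
  fixes f :: "nat \<Rightarrow> 'a::{t2_space, comm_monoid_add}"
  assumes "\<And>k. k \<noteq> n \<Longrightarrow> f k = 0"
  shows "suminf f = f n"
  using suminf_finite[of "{n}" f] assms by simp

lemma lpnorm_powr:
  assumes "p > 0" "f \<in> lp p"
  shows "lpnorm p f powr p = (\<Sum>n. norm (f n) powr p)"
  using assms by (simp add: lpnorm_def powr_powr lp_def suminf_nonneg)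

lemma lp_isometryD:
  assumes "lp_isometry p T" "f \<in> lp p"
  shows lp_isometry_in: "T f \<in> lp p"
    and lp_isometry_norm: "lpnorm p (T f) = lpnorm p f"
    and lp_isometry_suminf: "p > 0 \<Longrightarrow> (\<Sum>n. norm (T f n) powr p) = (\<Sum>n. norm (f n) powr p)"
proof -
  show *: "T f \<in> lp p" "lpnorm p (T f) = lpnorm p f"
    using assms by (auto simp: lp_isometry_def bij_betw_def)
  thus "(\<Sum>n. norm (T f n) powr p) = (\<Sum>n. norm (f n) powr p)" if "p > 0"
    using lpnorm_powr[OF that assms(2)] lpnorm_powr[OF that *(1)] *(2) by simp
qed

lemma lp_isometry_lincomb:
  "lp_isometry p T \<Longrightarrow> f \<in> lp p \<Longrightarrow> h \<in> lp p \<Longrightarrow>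
    T (\<lambda>n. a * f n + b * h n) = (\<lambda>n. a * T f n + b * T h n)"
  unfolding lp_isometry_def by blast

lemma lp_isometry_add:
  "lp_isometry p T \<Longrightarrow> f \<in> lp p \<Longrightarrow> h \<in> lp p \<Longrightarrow> T (\<lambda>n. f n + h n) = (\<lambda>n. T f n + T h n)"
  and lp_isometry_diff:
  "lp_isometry p T \<Longrightarrow> f \<in> lp p \<Longrightarrow> h \<in> lp p \<Longrightarrow> T (\<lambda>n. f n - h n) = (\<lambda>n. T f n - T h n)"
  and lp_isometry_zero: "lp_isometry p T \<Longrightarrow> T (\<lambda>n. 0) = (\<lambda>n. 0)"
  using lp_isometry_lincomb[of p T f h 1 1] lp_isometry_lincomb[of p T f h 1 "-1"]
    lp_isometry_lincomb[of p T "\<lambda>n. 0" "\<lambda>n. 0" 0 0]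
  by simp_all

text \<open>Equality in Clarkson's inequality characterises disjointness of supports.\<close>
lemma lp_isometry_disjoint:
  assumes p: "p > 0" "p \<noteq> 2" and T: "lp_isometry p T" and fh: "f \<in> lp p" "h \<in> lp p"
    and disj: "\<And>n. f n * h n = 0"
  shows "T f n * T h n = 0"
proof -
  let ?s = "\<lambda>f h. \<Sum>n. clarkson_defect p (f n) (h n)"
  have split: "?s f h = (\<Sum>n. norm (f n + h n) powr p) + (\<Sum>n. norm (f n - h n) powr p)
        - 2 * ((\<Sum>n. norm (f n) powr p) + (\<Sum>n. norm (h n) powr p))"
    and summ: "summable (\<lambda>n. clarkson_defect p (f n) (h n))"
    if "f \<in> lp p" "h \<in> lp p" for f h
  proof -
    have "summable (\<lambda>n. norm (f n + h n) powr p)" "summable (\<lambda>n. norm (f n - h n) powr p)"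
      "summable (\<lambda>n. norm (f n) powr p)" "summable (\<lambda>n. norm (h n) powr p)"
      using lp_add[OF p(1) that] lp_diff[OF p(1) that] that by (auto simp: lp_def)
    hence "(\<lambda>n. clarkson_defect p (f n) (h n)) sums ((\<Sum>n. norm (f n + h n) powr p)
        + (\<Sum>n. norm (f n - h n) powr p) - 2 * ((\<Sum>n. norm (f n) powr p) + (\<Sum>n. norm (h n) powr p)))"
      unfolding clarkson_defect_def by (intro sums_add sums_diff sums_mult summable_sums)
    thus "?s f h = (\<Sum>n. norm (f n + h n) powr p) + (\<Sum>n. norm (f n - h n) powr p)
        - 2 * ((\<Sum>n. norm (f n) powr p) + (\<Sum>n. norm (h n) powr p))"
      "summable (\<lambda>n. clarkson_defect p (f n) (h n))" by (simp_all add: sums_iff)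
  qed
  note TF = lp_isometry_in[OF T fh(1)] lp_isometry_in[OF T fh(2)]
  \<comment> \<open>The total defect is a combination of the p-norms of f + h, f - h, f and h, all
    of which T preserves.\<close>
  have "?s (T f) (T h) = ?s f h"
    unfolding split[OF fh] split[OF TF]
    using lp_isometry_suminf[OF T lp_add[OF p(1) fh] p(1)] lp_isometry_suminf[OF T lp_diff[OF p(1) fh] p(1)]
      lp_isometry_suminf[OF T fh(1) p(1)] lp_isometry_suminf[OF T fh(2) p(1)]
    by (simp add: lp_isometry_add[OF T fh] lp_isometry_diff[OF T fh])
  also have "\<dots> = 0" using disj by (simp add: clarkson_defect_eq_0)
  finally have 0: "?s (T f) (T h) = 0" .
  show ?thesis
  proof (cases "p > 2")
    case True
    have "clarkson_defect p (T f n) (T h n) \<ge> 0" for n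
      using clarkson_defect_pos[OF True] clarkson_defect_eq_0 by (cases "T f n * T h n = 0") (auto intro: less_imp_le)
    hence "\<forall>n. clarkson_defect p (T f n) (T h n) = 0"
      using suminf_eq_zero_iff[OF summ[OF TF]] 0 by blast
    thus ?thesis using clarkson_defect_pos[OF True, of "T f n" "T h n"] by force
  next
    case False
    hence p2: "p < 2" using p by linarith
    have "- clarkson_defect p (T f n) (T h n) \<ge> 0" for n
      using clarkson_defect_neg[OF p(1) p2, of "T f n" "T h n"] clarkson_defect_eq_0[of "T f n" "T h n" p]
      by (cases "T f n * T h n = 0") auto
    hence "\<forall>n. - clarkson_defect p (T f n) (T h n) = 0"
      using suminf_eq_zero_iff[OF summable_minus[OF summ[OF TF]]] suminf_minus[OF summ[OF TF]] 0 by simp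
    thus ?thesis using clarkson_defect_neg[OF p(1) p2, of "T f n" "T h n"] by force
  qed
qed

text \<open>Split the image of a unit vector into one nonzero coordinate u and the rest v. The
  inverse S keeps u and v disjoint while their images add up to a unit vector, so one image is zero;
  it must be that of v. Preservation of the norm then makes the coefficient a phase.\<close>

lemma lp_isometry_unit_vec:
  assumes p: "p > 0" "p \<noteq> 2" and T: "lp_isometry p T" and S: "lp_isometry p S"
    and ST: "\<And>f. f \<in> lp p \<Longrightarrow> S (T f) = f" and TS: "\<And>f. f \<in> lp p \<Longrightarrow> T (S f) = f"
  shows "\<exists>m c. norm c = 1 \<and> T (unit_vec n) = (\<lambda>k. c * unit_vec m k)"
proof -
  let ?g = "T (unit_vec n)"
  have g: "?g \<in> lp p" by (rule lp_isometry_in[OF T]) simp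
  have "?g \<noteq> (\<lambda>n. 0)"
    using ST[of "unit_vec n"] lp_isometry_zero[OF S] by (metis unit_vec_in_lp unit_vec_simps(1) zero_neq_one)
  then obtain m where m: "?g m \<noteq> 0" by auto
  define u where "u = (\<lambda>k. if k = m then ?g k else 0)"
  define v where "v = (\<lambda>k. if k \<noteq> m then ?g k else 0)"
  have uv: "u \<in> lp p" "v \<in> lp p" unfolding u_def v_def by (intro lp_restrict g)+
  have disj: "S u k * S v k = 0" for k
    by (rule lp_isometry_disjoint[OF p S uv]) (simp add: u_def v_def)
  have "(\<lambda>k. u k + v k) = ?g" by (auto simp: u_def v_def)
  hence sum: "S u k + S v k = unit_vec n k" for k
    using lp_isometry_add[OF S uv] ST[of "unit_vec n"] by (metis unit_vec_in_lp)
  have off: "S u k = 0 \<and> S v k = 0" if "k \<noteq> n" for k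
    using disj[of k] sum[of k] that by auto
  have "S u n \<noteq> 0"
  proof
    assume "S u n = 0"
    hence "S u = (\<lambda>k. 0)" using off by (metis (no_types))
    hence "u = (\<lambda>k. 0)" using TS[OF uv(1)] lp_isometry_zero[OF T] by simp
    thus False using m by (metis u_def)
  qed
  hence "S v n = 0" using disj[of n] by simp
  hence "S v = (\<lambda>k. 0)" using off by (metis (no_types))
  hence "v = (\<lambda>k. 0)" using TS[OF uv(2)] lp_isometry_zero[OF T] by simp
  hence "?g k = 0" if "k \<noteq> m" for k using that by (metis v_def)
  hence eq: "?g = (\<lambda>k. ?g m * unit_vec m k)" by (auto simp: unit_vec_def)
  have "(\<Sum>k. norm (?g k) powr p) = (\<Sum>k. norm (unit_vec n k) powr p)"
    by (rule lp_isometry_suminf[OF T _ p(1)]) simp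
  also have "\<dots> = norm (unit_vec n n) powr p" by (rule suminf_single) (simp add: unit_vec_powr)
  also have "(\<Sum>k. norm (?g k) powr p) = norm (?g m) powr p"
    using \<open>\<And>k. k \<noteq> m \<Longrightarrow> ?g k = 0\<close> by (intro suminf_single) simp
  finally have "norm (?g m) powr p = 1" by simp
  hence "(norm (?g m) powr p) powr (1 / p) = 1" by simp
  hence "norm (?g m) = 1" using p by (simp add: powr_powr)
  with eq show ?thesis by blast
qed

text \<open>The permutation and the phases are read off from the unit vectors. The formula for
  general f needs no density argument: f without its n-th coordinate is disjoint from the n-th unit
  vector, so its image vanishes at \<open>\<sigma> n\<close>. Surjectivity of
  \<open>\<sigma>\<close> comes from applying the unit vector result to the inverse S.\<close>

theorem Banach_Lamperti:
  assumes p: "p > 0" "p \<noteq> 2" and T: "lp_isometry p T" and S: "lp_isometry p S"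
    and ST: "\<And>f. f \<in> lp p \<Longrightarrow> S (T f) = f" and TS: "\<And>f. f \<in> lp p \<Longrightarrow> T (S f) = f"
  obtains \<sigma> c where "bij \<sigma>" "\<And>n. norm (c n) = 1" "\<And>f n. f \<in> lp p \<Longrightarrow> T f (\<sigma> n) = c n * f n"
proof -
  obtain \<sigma> c where c: "\<And>n. norm (c n) = 1" and Te: "\<And>n. T (unit_vec n) = (\<lambda>k. c n * unit_vec (\<sigma> n) k)"
    using lp_isometry_unit_vec[OF assms] by metis
  have c0: "c n \<noteq> 0" for n using c[of n] by auto
  have Tf: "T f (\<sigma> n) = c n * f n" if f: "f \<in> lp p" for f n
  proof -
    define f' where "f' = (\<lambda>k. if k \<noteq> n then f k else 0)"
    have f': "f' \<in> lp p" unfolding f'_def by (rule lp_restrict[OF f])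
    have "T f' (\<sigma> n) * T (unit_vec n) (\<sigma> n) = 0"
      by (rule lp_isometry_disjoint[OF p T f']) (auto simp: f'_def unit_vec_def)
    hence "T f' (\<sigma> n) = 0" using c0 by (simp add: Te)
    moreover have "f = (\<lambda>k. f n * unit_vec n k + 1 * f' k)" by (auto simp: f'_def unit_vec_def)
    hence "T f = (\<lambda>k. f n * T (unit_vec n) k + 1 * T f' k)"
      using lp_isometry_lincomb[OF T unit_vec_in_lp f', of "f n" n 1] by simp
    ultimately show ?thesis by (simp add: Te)
  qed
  have "inj \<sigma>"
  proof (rule injI, rule ccontr)
    fix m n assume "\<sigma> m = \<sigma> n" "m \<noteq> n"
    moreover have "T (unit_vec m) (\<sigma> n) = c n * unit_vec m n" by (rule Tf) simp
    ultimately show False using c0[of m] by (simp add: Te)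
  qed
  moreover have "surj \<sigma>"
    unfolding surj_def
  proof (rule allI)
    fix m
    obtain k d where d: "norm d = 1" "S (unit_vec m) = (\<lambda>j. d * unit_vec k j)"
      using lp_isometry_unit_vec[OF p S T TS ST, of m] by blast
    have "T (S (unit_vec m)) (\<sigma> k) = c k * S (unit_vec m) k"
      by (rule Tf[OF lp_isometry_in[OF S]]) simp
    hence "unit_vec m (\<sigma> k) = c k * d" using TS[of "unit_vec m"] d by simp
    moreover have "c k * d \<noteq> 0" using c0 d by auto
    ultimately have "\<sigma> k = m" by (metis unit_vec_simps(2))
    thus "\<exists>k. m = \<sigma> k" by blast
  qed
  ultimately have "bij \<sigma>" by (simp add: bij_def)
  thus ?thesis using that c Tf by blast
qed

section \<open>Consequences of the Howe--Moore property\<close>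

lemma orth_repI:
  fixes \<pi> :: "'g::topological_group_add \<Rightarrow> (nat \<Rightarrow> complex) \<Rightarrow> nat \<Rightarrow> complex"
  assumes lin: "\<And>g f h a b. \<pi> g (\<lambda>n. a * f n + b * h n) = (\<lambda>n. a * \<pi> g f n + b * \<pi> g h n)"
    and hom: "\<And>g h f. \<pi> (g + h) f = \<pi> g (\<pi> h f)" and zero: "\<And>f. \<pi> 0 f = f"
    and lp: "\<And>g f. f \<in> lp p \<Longrightarrow> \<pi> g f \<in> lp p"
    and iso: "\<And>g f. f \<in> lp p \<Longrightarrow> (\<Sum>n. norm (\<pi> g f n) powr p) = (\<Sum>n. norm (f n) powr p)"
    and cont: "\<And>f g0. f \<in> lp p \<Longrightarrow> ((\<lambda>g. lpnorm p (\<lambda>n. \<pi> g f n - \<pi> g0 f n)) \<longlongrightarrow> 0) (at g0)"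
  shows "orth_rep p \<pi>"
proof -
  have "bij_betw (\<pi> g) (lp p) (lp p)" for g
    by (rule bij_betw_byWitness[of _ "\<pi> (- g)"]) (auto simp: lp zero simp flip: hom)
  thus ?thesis
    using iso unfolding orth_rep_def lp_isometry_def
    by (simp add: lin hom zero cont) (simp add: lpnorm_def)
qed

text \<open>The index \<open>m * d + i\<close> stands for coordinate i of the m-th copy of a
  d-dimensional space. An estimate holding in each copy with a common constant passes to the whole
  sum.\<close>

lemma block_sum_le:
  fixes a b :: "nat \<Rightarrow> real"
  assumes d: "d > 0" and a: "\<And>n. a n \<ge> 0" and b: "\<And>n. b n \<ge> 0" "summable b" and C: "C \<ge> 0"
    and le: "\<And>m. (\<Sum>i<d. a (m * d + i)) \<le> C * (\<Sum>i<d. b (m * d + i))"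
  shows "summable a" "suminf a \<le> C * suminf b"
proof -
  have shift: "sum f {m * d..<m * d + d} = (\<Sum>i<d. f (m * d + i))" for f :: "nat \<Rightarrow> real" and m
    using sum.shift_bounds_nat_ivl[of f 0 "m * d" d] by (simp add: add.commute lessThan_atLeast0)
  have bd: "sum a {..<N} \<le> C * suminf b" for N
  proof -
    have "sum a {..<N} \<le> sum a {..<N * d}"
      using d a by (intro sum_mono2) auto
    also have "\<dots> = (\<Sum>m<N. \<Sum>i<d. a (m * d + i))"
      by (simp add: sum.nat_group[symmetric] shift)
    also have "\<dots> \<le> (\<Sum>m<N. C * (\<Sum>i<d. b (m * d + i)))" by (intro sum_mono le)
    also have "\<dots> = C * sum b {..<N * d}"
      by (simp add: sum.nat_group[symmetric] shift sum_distrib_left)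
    also have "\<dots> \<le> C * suminf b"
      using C b by (intro mult_left_mono sum_le_suminf) auto
    finally show ?thesis .
  qed
  show "summable a" by (rule summableI_nonneg_bounded[OF a bd])
  thus "suminf a \<le> C * suminf b" using bd by (intro suminf_le_const) auto
qed

lemma norm_powr_2: "norm (z::complex) powr 2 = (norm z)\<^sup>2"
  by (simp add: powr_numeral)

lemma norm_sum_mult_square_le:
  fixes a x :: "'i \<Rightarrow> complex"
  shows "(norm (\<Sum>j\<in>J. a j * x j))\<^sup>2 \<le> (\<Sum>j\<in>J. (norm (a j))\<^sup>2) * (\<Sum>j\<in>J. (norm (x j))\<^sup>2)"
proof -
  have "norm (\<Sum>j\<in>J. a j * x j) \<le> (\<Sum>j\<in>J. \<bar>norm (a j)\<bar> * \<bar>norm (x j)\<bar>)"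
    by (rule order_trans[OF norm_sum]) (simp add: norm_mult)
  also have "\<dots> \<le> L2_set (\<lambda>j. norm (a j)) J * L2_set (\<lambda>j. norm (x j)) J"
    by (rule L2_set_mult_ineq)
  finally have "(norm (\<Sum>j\<in>J. a j * x j))\<^sup>2 \<le> (L2_set (\<lambda>j. norm (a j)) J * L2_set (\<lambda>j. norm (x j)) J)\<^sup>2"
    by (intro power_mono) auto
  thus ?thesis by (simp add: power_mult_distrib L2_set_def sum_nonneg)
qed

lemma lpnorm_tendsto_0I:
  assumes p: "p > 0" and f: "\<And>g. f g \<in> lp p"
    and le: "eventually (\<lambda>g. (\<Sum>n. norm (f g n) powr p) \<le> B g) F" and B: "(B \<longlongrightarrow> 0) F"
  shows "((\<lambda>g. lpnorm p (f g)) \<longlongrightarrow> 0) F"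
proof -
  have nonneg: "0 \<le> (\<Sum>n. norm (f g n) powr p)" for g
    using f[of g] by (intro suminf_nonneg) (auto simp: lp_def)
  have "((\<lambda>g. \<Sum>n. norm (f g n) powr p) \<longlongrightarrow> 0) F"
    by (rule Lim_null_comparison[OF _ B]) (use le nonneg in simp)
  thus ?thesis
    unfolding lpnorm_def using p nonneg by (intro tendsto_zero_powrI[OF _ tendsto_const]) auto
qed

lemma l2inner_unit_vec: "l2inner f (unit_vec i) = f i"
proof -
  have "l2inner f (unit_vec i) = f i * cnj (unit_vec i i)"
    unfolding l2inner_def by (rule suminf_single) simp
  thus ?thesis by simp
qed

text \<open>Definition \<open>howe_moore\<close> only speaks about representations on \<open>l2\<close>; a matrix representation is
  brought into this form by taking countably many copies of it.\<close>
lemma howe_moore_matrix_rep: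
  fixes M :: "'g::topological_group_add \<Rightarrow> nat \<Rightarrow> nat \<Rightarrow> complex"
  assumes HM: "howe_moore TYPE('g)" and d: "d > 0"
    and hom: "\<And>g h i j. i < d \<Longrightarrow> j < d \<Longrightarrow> M (g + h) i j = (\<Sum>k<d. M g i k * M h k j)"
    and zero: "\<And>i j. i < d \<Longrightarrow> j < d \<Longrightarrow> M 0 i j = (if i = j then 1 else 0)"
    and adj: "\<And>g i j. i < d \<Longrightarrow> j < d \<Longrightarrow> M (- g) i j = cnj (M g j i)"
    and cont: "\<And>g0 i j. i < d \<Longrightarrow> j < d \<Longrightarrow> ((\<lambda>g. M g i j) \<longlongrightarrow> M g0 i j) (at g0)"
    and noinv: "\<And>v i. (\<And>g i. i < d \<Longrightarrow> (\<Sum>j<d. M g i j * v j) = v i) \<Longrightarrow> i < d \<Longrightarrow> v i = 0"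
  shows "compact (UNIV :: 'g set)"
proof -
  \<comment> \<open>\<open>n div d\<close> names the copy and \<open>n mod d\<close> the coordinate:
    the same matrix acts on every block.\<close>
  define \<pi> where "\<pi> g f n = (\<Sum>j<d. M g (n mod d) j * f (n div d * d + j))" for g and f :: "nat \<Rightarrow> complex" and n
  have \<pi>_block: "\<pi> g f (m * d + i) = (\<Sum>j<d. M g i j * f (m * d + j))" if "i < d" for g f m i
    using that by (simp add: \<pi>_def)
  have unit: "(\<Sum>i<d. cnj (M g i k) * M g i j) = (if k = j then 1 else 0)" if "j < d" "k < d" for g j k
  proof -
    have "(\<Sum>i<d. cnj (M g i k) * M g i j) = (\<Sum>i<d. M (- g) k i * M g i j)"
      using that adj by (intro sum.cong) auto
    also have "\<dots> = M (- g + g) k j" using that by (simp only: hom)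
    finally show ?thesis using that zero by simp
  qed
  have norm_block: "(\<Sum>i<d. (norm (\<Sum>j<d. M g i j * x j))\<^sup>2) = (\<Sum>j<d. (norm (x j))\<^sup>2)" for g x
  proof -
    have "complex_of_real (\<Sum>i<d. (norm (\<Sum>j<d. M g i j * x j))\<^sup>2)
        = (\<Sum>i<d. (\<Sum>j<d. M g i j * x j) * (\<Sum>k<d. cnj (M g i k) * cnj (x k)))"
      by (simp add: complex_norm_square cnj_sum del: of_real_power)
    also have "\<dots> = (\<Sum>i<d. \<Sum>j<d. \<Sum>k<d. x j * cnj (x k) * (cnj (M g i k) * M g i j))"
      by (simp add: sum_product mult_ac)
    also have "\<dots> = (\<Sum>j<d. \<Sum>i<d. \<Sum>k<d. x j * cnj (x k) * (cnj (M g i k) * M g i j))"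
      by (rule sum.swap)
    also have "\<dots> = (\<Sum>j<d. \<Sum>k<d. \<Sum>i<d. x j * cnj (x k) * (cnj (M g i k) * M g i j))"
      by (intro sum.cong refl sum.swap)
    also have "\<dots> = (\<Sum>j<d. \<Sum>k<d. x j * cnj (x k) * (if k = j then 1 else 0))"
      by (intro sum.cong refl) (simp add: unit flip: sum_distrib_left)
    also have "\<dots> = (\<Sum>j<d. x j * cnj (x j))" by (simp add: if_distrib cong: if_cong)
    also have "\<dots> = complex_of_real (\<Sum>j<d. (norm (x j))\<^sup>2)"
      by (simp add: complex_norm_square del: of_real_power)
    finally show ?thesis by (simp only: of_real_eq_iff)
  qed
  have \<pi>_sum: "(\<Sum>i<d. norm (\<pi> g f (m * d + i)) powr 2) = (\<Sum>i<d. norm (f (m * d + i)) powr 2)" for g f m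
    using norm_block[of g "\<lambda>j. f (m * d + j)"] by (simp add: \<pi>_block norm_powr_2)
  have \<pi>_lp: "\<pi> g f \<in> lp 2" if "f \<in> lp 2" for g f
    using block_sum_le(1)[of d "\<lambda>n. norm (\<pi> g f n) powr 2" "\<lambda>n. norm (f n) powr 2" 1] that d
    by (simp add: lp_def \<pi>_sum del: powr_numeral)
  have rep: "unitary_rep \<pi>"
  proof (rule orth_repI)
    show "\<pi> g (\<lambda>n. a * f n + b * h n) = (\<lambda>n. a * \<pi> g f n + b * \<pi> g h n)" for g f h a b
      by (rule ext) (simp add: \<pi>_def algebra_simps sum.distrib sum_distrib_left)
    show "\<pi> (g + h) f = \<pi> g (\<pi> h f)" for g h f
    proof
      fix n
      let ?i = "n mod d" and ?m = "n div d"
      have i: "?i < d" using d by simp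
      have "\<pi> (g + h) f n = (\<Sum>j<d. \<Sum>k<d. M g ?i k * M h k j * f (?m * d + j))"
        unfolding \<pi>_def using i by (intro sum.cong) (auto simp: hom sum_distrib_right)
      also have "\<dots> = (\<Sum>k<d. \<Sum>j<d. M g ?i k * M h k j * f (?m * d + j))" by (rule sum.swap)
      also have "\<dots> = (\<Sum>k<d. M g ?i k * \<pi> h f (?m * d + k))"
        by (intro sum.cong refl) (simp add: \<pi>_block sum_distrib_left mult.assoc)
      finally show "\<pi> (g + h) f n = \<pi> g (\<pi> h f) n" by (simp add: \<pi>_def)
    qed
    show "\<pi> 0 f = f" for f
    proof
      fix n
      have "\<pi> 0 f n = (\<Sum>j<d. (if n mod d = j then 1 else 0) * f (n div d * d + j))"
        unfolding \<pi>_def using d by (intro sum.cong) (auto simp: zero)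
      also have "\<dots> = (\<Sum>j<d. if j = n mod d then f n else 0)"
        by (intro sum.cong) auto
      also have "\<dots> = f n" using d by simp
      finally show "\<pi> 0 f n = f n" .
    qed
    show "\<pi> g f \<in> lp 2" if "f \<in> lp 2" for g f using \<pi>_lp[OF that] .
    show "(\<Sum>n. norm (\<pi> g f n) powr 2) = (\<Sum>n. norm (f n) powr 2)" if f: "f \<in> lp 2" for g f
    proof (rule antisym)
      have s: "summable (\<lambda>n. norm (f n) powr 2)" "summable (\<lambda>n. norm (\<pi> g f n) powr 2)"
        using f \<pi>_lp[OF f] by (simp_all add: lp_def del: powr_numeral)
      show "(\<Sum>n. norm (\<pi> g f n) powr 2) \<le> (\<Sum>n. norm (f n) powr 2)"
        using block_sum_le(2)[OF d _ _ s(1), of "\<lambda>n. norm (\<pi> g f n) powr 2" 1] \<pi>_sum by simp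
      show "(\<Sum>n. norm (f n) powr 2) \<le> (\<Sum>n. norm (\<pi> g f n) powr 2)"
        using block_sum_le(2)[OF d _ _ s(2), of "\<lambda>n. norm (f n) powr 2" 1] \<pi>_sum by simp
    qed
    show "((\<lambda>g. lpnorm 2 (\<lambda>n. \<pi> g f n - \<pi> g0 f n)) \<longlongrightarrow> 0) (at g0)" if f: "f \<in> lp 2" for f g0
    proof (rule lpnorm_tendsto_0I)
      \<comment> \<open>The squared Hilbert-Schmidt norm of the difference of the two matrices, a
        bound common to all blocks.\<close>
      define C where "C g = (\<Sum>i<d. \<Sum>j<d. (norm (M g i j - M g0 i j))\<^sup>2)" for g
      let ?S = "\<lambda>g. \<Sum>n. norm (\<pi> g f n - \<pi> g0 f n) powr 2"
      have s: "summable (\<lambda>n. norm (f n) powr 2)" using f by (simp add: lp_def del: powr_numeral)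
      have le: "?S g \<le> C g * (\<Sum>n. norm (f n) powr 2)" for g
      proof (rule block_sum_le(2)[OF d _ _ s])
        show "0 \<le> C g" by (simp add: C_def sum_nonneg)
        fix m
        have "(norm (\<pi> g f (m * d + i) - \<pi> g0 f (m * d + i)))\<^sup>2
            \<le> (\<Sum>j<d. (norm (M g i j - M g0 i j))\<^sup>2) * (\<Sum>j<d. (norm (f (m * d + j)))\<^sup>2)" if "i < d" for i
          using norm_sum_mult_square_le[of "\<lambda>j. M g i j - M g0 i j" "\<lambda>j. f (m * d + j)" "{..<d}"] that
          by (simp add: \<pi>_block left_diff_distrib sum_subtractf)
        hence "(\<Sum>i<d. (norm (\<pi> g f (m * d + i) - \<pi> g0 f (m * d + i)))\<^sup>2)
            \<le> (\<Sum>i<d. (\<Sum>j<d. (norm (M g i j - M g0 i j))\<^sup>2) * (\<Sum>j<d. (norm (f (m * d + j)))\<^sup>2))"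
          by (intro sum_mono) simp
        thus "(\<Sum>i<d. norm (\<pi> g f (m * d + i) - \<pi> g0 f (m * d + i)) powr 2)
            \<le> C g * (\<Sum>i<d. norm (f (m * d + i)) powr 2)"
          by (simp add: norm_powr_2 C_def sum_distrib_right)
      qed auto
      have "(C \<longlongrightarrow> (\<Sum>i<d. \<Sum>j<d. (norm (M g0 i j - M g0 i j))\<^sup>2)) (at g0)"
        unfolding C_def by (intro tendsto_sum tendsto_power tendsto_norm tendsto_diff cont tendsto_const) auto
      hence C0: "(C \<longlongrightarrow> 0) (at g0)" by simp
      have "((\<lambda>g. C g * (\<Sum>n. norm (f n) powr 2)) \<longlongrightarrow> 0) (at g0)"
        by (rule tendsto_mult_left_zero[OF C0])
      thus "((\<lambda>g. C g * (\<Sum>n. norm (f n) powr 2)) \<longlongrightarrow> 0) (at g0)" .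
      show "eventually (\<lambda>g. ?S g \<le> C g * (\<Sum>n. norm (f n) powr 2)) (at g0)"
        using le by simp
      show "(\<lambda>n. \<pi> g f n - \<pi> g0 f n) \<in> lp 2" for g
        by (intro lp_diff \<pi>_lp f) simp
    qed simp
  qed
  have "\<not> (\<exists>\<xi>\<in>lp 2. \<xi> \<noteq> (\<lambda>n. 0) \<and> (\<forall>g. \<pi> g \<xi> = \<xi>))"
  proof safe
    fix \<xi> assume \<xi>: "\<xi> \<noteq> (\<lambda>n. 0)" "\<forall>g. \<pi> g \<xi> = \<xi>"
    have "\<xi> n = 0" for n
    proof -
      have "\<xi> (n div d * d + n mod d) = 0"
      proof (rule noinv[where v="\<lambda>i. \<xi> (n div d * d + i)"])
        show "(\<Sum>j<d. M g i j * \<xi> (n div d * d + j)) = \<xi> (n div d * d + i)" if "i < d" for g i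
          using \<pi>_block[OF that, of g \<xi> "n div d"] \<xi>(2) by metis
      qed (use d in simp)
      thus ?thesis by simp
    qed
    with \<xi>(1) show False by auto
  qed
  hence "vanishes_at_infinity (\<lambda>g. l2inner (\<pi> g (unit_vec 0)) (unit_vec i))" for i
    using HM rep unfolding howe_moore_def by (metis unit_vec_in_lp)
  hence "vanishes_at_infinity (\<lambda>g. \<pi> g (unit_vec 0) i)" for i
    by (simp add: l2inner_unit_vec)
  moreover have "\<pi> g (unit_vec 0) i = M g i 0" if "i < d" for g i
  proof -
    have "\<pi> g (unit_vec 0) (0 * d + i) = (\<Sum>j<d. if j = 0 then M g i 0 else 0)"
      unfolding \<pi>_block[OF that] by (intro sum.cong) (auto simp: unit_vec_def)
    thus ?thesis using d by simp
  qed
  ultimately have "\<forall>i<d. \<exists>K. compact K \<and> (\<forall>g. g \<notin> K \<longrightarrow> norm (M g i 0) < 1 / d)"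
    using d unfolding vanishes_at_infinity_def by (metis of_nat_0_less_iff zero_less_divide_1_iff)
  then obtain K where K: "\<And>i. i < d \<Longrightarrow> compact (K i)" "\<And>i g. i < d \<Longrightarrow> g \<notin> K i \<Longrightarrow> norm (M g i 0) < 1 / d"
    by metis
  \<comment> \<open>Outside all \<open>K i\<close>, every entry of column 0 is below
    \<open>1 / d\<close>, so its squared norm is below \<open>1 / d\<close>; but a column of a
    unitary matrix has norm 1.\<close>
  have "UNIV = (\<Union>i<d. K i)"
  proof (rule ccontr)
    assume "UNIV \<noteq> (\<Union>i<d. K i)"
    then obtain g where "g \<notin> (\<Union>i<d. K i)" by blast
    hence lt: "norm (M g i 0) < 1 / d" if "i < d" for i using K(2) that by blast
    have "1 = (\<Sum>i<d. cnj (M g i 0) * M g i 0)" using unit[of 0 0 g] d by simp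
    also have "\<dots> = complex_of_real (\<Sum>i<d. (norm (M g i 0))\<^sup>2)"
      by (simp add: complex_norm_square mult.commute del: of_real_power)
    finally have "1 = (\<Sum>i<d. (norm (M g i 0))\<^sup>2)" by (metis of_real_eq_1_iff)
    also have "\<dots> < (\<Sum>i<d. (1 / d)\<^sup>2)"
      using d lt by (intro sum_strict_mono power_strict_mono) auto
    also have "\<dots> = 1 / d" using d by (simp add: power2_eq_square)
    also have "\<dots> \<le> 1" using d by simp
    finally show False by simp
  qed
  thus ?thesis using K(1) by (metis compact_UN finite_lessThan lessThan_iff)
qed

text \<open>In the permutation representation an invariant vector is constant by transitivity, hence
  zero in \<open>l\<^sub>2\<close>. The diagonal coefficient at a unit vector is the indicator
  function of its stabiliser, and it can vanish at infinity only if the stabiliser lies in a compact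
  set.\<close>

lemma (in nat_action) howe_moore_transitive:
  assumes HM: "howe_moore TYPE('g)" and trans: "\<And>m n. \<exists>g. act g m = n"
  shows "compact (stab n)"
proof -
  define \<pi> where "\<pi> g f n = f (act (- g) n)" for g and f :: "nat \<Rightarrow> complex" and n
  have \<pi>_summable: "summable (\<lambda>n. norm (\<pi> g f n) powr 2)"
    and \<pi>_suminf: "(\<Sum>n. norm (\<pi> g f n) powr 2) = (\<Sum>n. norm (f n) powr 2)" if "f \<in> lp 2" for g f
    using summable_norm_reindex_bij[OF bij_act[of "- g"], of "\<lambda>n. norm (f n) powr 2"] that
    by (simp_all add: lp_def \<pi>_def del: powr_numeral)
  have \<pi>_lp: "\<pi> g f \<in> lp 2" if "f \<in> lp 2" for g f
    using \<pi>_summable[OF that] by (simp add: lp_def)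
  have rep: "unitary_rep \<pi>"
  proof (rule orth_repI)
    show "\<pi> (g + h) f = \<pi> g (\<pi> h f)" for g h f
      by (rule ext) (simp add: \<pi>_def minus_add act_add del: add_uminus_conv_diff)
    show "((\<lambda>g. lpnorm 2 (\<lambda>n. \<pi> g f n - \<pi> g0 f n)) \<longlongrightarrow> 0) (at g0)" if f: "f \<in> lp 2" for f g0
    proof (rule lpnorm_tendsto_0I)
      let ?S = "\<lambda>g. \<Sum>n. norm (\<pi> g f n - \<pi> g0 f n) powr 2"
      have d_lp: "(\<lambda>n. \<pi> g f n - \<pi> g0 f n) \<in> lp 2" for g
        by (intro lp_diff \<pi>_lp f) simp
      thus "(\<lambda>n. \<pi> g f n - \<pi> g0 f n) \<in> lp 2" for g .
      have S0: "0 \<le> ?S g" for g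
        using d_lp[of g] by (intro suminf_nonneg) (simp_all add: lp_def del: powr_numeral)
      show "(?S \<longlongrightarrow> 0) (at g0)"
      proof (rule tendstoI)
        fix e :: real assume e: "e > 0"
        have "summable (\<lambda>n. norm (f n) powr 2)" using f by (simp add: lp_def del: powr_numeral)
        \<comment> \<open>For g near g0 both actions agree below N, so the difference involves only
          the two translated tails. Each enters with the factor 4 from squaring a sum, whence the
          8.\<close>
        from suminf_exist_split[OF _ this, of "e / 8"] e obtain N where
          N: "norm (\<Sum>n. norm (f (n + N)) powr 2) < e / 8" by auto
        define t where "t = (\<lambda>n. if n \<ge> N then f n else 0)"
        have t: "t \<in> lp 2" unfolding t_def by (rule lp_restrict[OF f])
        have "(\<Sum>n. norm (t n) powr 2) = (\<Sum>n. norm (t (n + N)) powr 2) + (\<Sum>n<N. norm (t n) powr 2)"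
          using t by (intro suminf_split_initial_segment) (simp add: lp_def del: powr_numeral)
        hence t8: "(\<Sum>n. norm (t n) powr 2) < e / 8" using N by (simp add: t_def)
        have "open (\<Inter>n\<in>{..<N}. {g. act g n = act g0 n})"
          using open_act_eq by (intro open_INT) auto
        moreover have "g0 \<in> (\<Inter>n\<in>{..<N}. {g. act g n = act g0 n})" by simp
        ultimately have "eventually (\<lambda>g. g \<in> (\<Inter>n\<in>{..<N}. {g. act g n = act g0 n})) (at g0)"
          unfolding eventually_at_topological by blast
        thus "eventually (\<lambda>g. dist (?S g) 0 < e) (at g0)"
        proof eventually_elim
          case (elim g)
          have ag: "act g m = act g0 m" if "m < N" for m using elim that by simp
          have eq: "act (- g) n = act (- g0) n" if n: "act (- g) n < N \<or> act (- g0) n < N" for n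
            using n
          proof
            assume "act (- g) n < N"
            from ag[OF this] have "act g0 (act (- g) n) = n" by simp
            thus ?thesis using act_minus(1)[of g0 "act (- g) n"] by simp
          next
            assume "act (- g0) n < N"
            from ag[OF this] have "act g (act (- g0) n) = n" by simp
            thus ?thesis using act_minus(1)[of g "act (- g0) n"] by simp
          qed
          have "\<pi> g f n - \<pi> g0 f n = 1 * \<pi> g t n + (-1) * \<pi> g0 t n" for n
            using eq[of n] by (cases "act (- g) n < N \<or> act (- g0) n < N") (auto simp: \<pi>_def t_def)
          hence "norm (\<pi> g f n - \<pi> g0 f n) powr 2 \<le> 4 * norm (\<pi> g t n) powr 2 + 4 * norm (\<pi> g0 t n) powr 2" for n
            using norm_lincomb_powr_le[of 2 1 "\<pi> g t n" "-1" "\<pi> g0 t n"] by simp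
          hence "?S g \<le> (\<Sum>n. 4 * norm (\<pi> g t n) powr 2 + 4 * norm (\<pi> g0 t n) powr 2)"
            using d_lp[of g] \<pi>_summable[OF t]
            by (intro suminf_le summable_add summable_mult) (simp_all add: lp_def del: powr_numeral)
          also have "\<dots> = 8 * (\<Sum>n. norm (t n) powr 2)"
            using \<pi>_summable[OF t] \<pi>_suminf[OF t]
            by (simp add: summable_mult suminf_mult flip: suminf_add del: powr_numeral)
          finally show ?case using t8 S0[of g] by (simp add: dist_real_def del: powr_numeral)
        qed
      qed
    qed auto
  qed (use \<pi>_lp \<pi>_suminf in \<open>simp_all add: \<pi>_def[abs_def]\<close>)
  have "\<not> (\<exists>\<xi>\<in>lp 2. \<xi> \<noteq> (\<lambda>n. 0) \<and> (\<forall>g. \<pi> g \<xi> = \<xi>))"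
  proof safe
    fix \<xi> assume \<xi>: "\<xi> \<in> lp 2" "\<xi> \<noteq> (\<lambda>n. 0)" "\<forall>g. \<pi> g \<xi> = \<xi>"
    have const: "\<xi> n = \<xi> 0" for n
    proof -
      obtain g where "act (- g) n = 0" using trans[of n 0] by (metis minus_minus)
      thus ?thesis using \<xi>(3) by (metis \<pi>_def)
    qed
    then obtain c where c: "\<xi> = (\<lambda>n. c)" by blast
    have "summable (\<lambda>n::nat. norm c powr 2)"
      using \<xi>(1) by (simp add: c lp_def del: powr_numeral)
    thus False using \<xi>(2) by (simp add: c summable_const_iff)
  qed
  hence "vanishes_at_infinity (\<lambda>g. l2inner (\<pi> g (unit_vec n)) (unit_vec n))"
    using HM rep unfolding howe_moore_def by (metis unit_vec_in_lp)
  then obtain K where K: "compact K" "\<And>g. g \<notin> K \<Longrightarrow> norm (\<pi> g (unit_vec n) n) < 1"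
    unfolding vanishes_at_infinity_def l2inner_unit_vec using zero_less_one by blast
  have "stab n \<subseteq> K"
  proof
    fix g assume "g \<in> stab n"
    hence "act (- g) n = n" using open_subgroup_stab[of n] by (auto simp: open_subgroup_def stab_def)
    thus "g \<in> K" using K(2)[of g] by (auto simp: \<pi>_def)
  qed
  thus ?thesis
    using compact_Int_closed[OF K(1) open_subgroup_closed[OF open_subgroup_stab[of n]]] by (simp add: inf_absorb2)
qed

text \<open>The columns of \<open>B\<close> form an orthonormal basis of the orthogonal complement of the constants;
  it arises from the Householder reflection exchanging the normalised constant vector with
  the first basis vector.\<close>
lemma sum_zero_orthonormal_basis:
  fixes d :: nat
  assumes d: "d \<ge> 2"
  obtains B :: "nat \<Rightarrow> nat \<Rightarrow> real" where
    "\<And>j. j < d - 1 \<Longrightarrow> (\<Sum>i<d. B i j) = 0"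
    "\<And>j k. j < d - 1 \<Longrightarrow> k < d - 1 \<Longrightarrow> (\<Sum>i<d. B i j * B i k) = (if j = k then 1 else 0)"
    "\<And>i k. i < d \<Longrightarrow> k < d \<Longrightarrow> (\<Sum>j<d-1. B i j * B k j) = (if i = k then 1 else 0) - 1 / d"
proof -
  obtain n where n: "d = Suc n" "n > 0" using d by (cases d) auto
  define \<beta> where "\<beta> = 1 / sqrt d"
  \<comment> \<open>Let u have all entries \<open>\<beta>\<close> and put w = e_0 - u. Reflection
    along w sends e_(j+1) to e_(j+1) + \<beta>/(1 - \<beta>) w. Away from row 0 this subtracts
    \<beta>^2/(1 - \<beta>), which equals \<open>\<alpha>\<close> because \<beta>^2 = 1/d.\<close>
  define \<alpha> where "\<alpha> = (1 + \<beta>) / n"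
  have \<beta>: "\<beta> * \<beta> = 1 / d" by (simp add: \<beta>_def)
  have \<alpha>: "n * \<alpha> = 1 + \<beta>" using n by (simp add: \<alpha>_def)
  have key: "\<beta> * \<beta> - 2 * \<alpha> + n * \<alpha> * \<alpha> = 0"
  proof -
    have "n * (\<beta> * \<beta> - 2 * \<alpha> + n * \<alpha> * \<alpha>) = n * (\<beta> * \<beta>) - 2 * (n * \<alpha>) + (n * \<alpha>) * (n * \<alpha>)"
      by (simp add: algebra_simps)
    also have "\<dots> = (n + 1) * (\<beta> * \<beta>) - 1" unfolding \<alpha> by (simp add: algebra_simps)
    also have "\<dots> = 0" unfolding \<beta> using n by simp
    finally show ?thesis using n by simp
  qed
  define B where "B i j = (if i = 0 then \<beta> else if i = Suc j then 1 - \<alpha> else - \<alpha>)" for i j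
  have B0: "B 0 j = \<beta>" for j by (simp add: B_def)
  have BS: "B (Suc i) j = (if i = j then 1 else 0) - \<alpha>" for i j by (simp add: B_def)
  show ?thesis
  proof (rule that[of B])
    show "(\<Sum>i<d. B i j) = 0" if "j < d - 1" for j
      unfolding n(1) sum.lessThan_Suc_shift B0 BS using that n \<alpha> by (simp add: sum_subtractf)
    show "(\<Sum>i<d. B i j * B i k) = (if j = k then 1 else 0)" if "j < d - 1" "k < d - 1" for j k
    proof -
      have "(\<Sum>i<d. B i j * B i k) = \<beta> * \<beta> + (\<Sum>i<n. (if i = j then if j = k then 1 else 0 else 0)
          - \<alpha> * (if i = j then 1 else 0) - \<alpha> * (if i = k then 1 else 0) + \<alpha> * \<alpha>)"
        unfolding n(1) sum.lessThan_Suc_shift B0 BS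
        by (intro arg_cong2[of _ _ _ _ "(+)"] refl sum.cong) (auto simp: algebra_simps)
      also have "\<dots> = \<beta> * \<beta> + ((if j = k then 1 else 0) - \<alpha> - \<alpha> + n * (\<alpha> * \<alpha>))"
        using that n by (simp add: sum.distrib sum_subtractf flip: sum_distrib_left)
      also have "\<dots> = (if j = k then 1 else 0)" using key by (simp add: mult.assoc)
      finally show ?thesis .
    qed
    have d1: "d - 1 = n" using n by simp
    have row0: "(\<Sum>j<n. B 0 j * B (Suc i) j) = - 1 / d" if "i < n" for i
    proof -
      have "(\<Sum>j<n. B 0 j * B (Suc i) j) = \<beta> * (1 - n * \<alpha>)"
        using that by (simp add: B0 BS sum_subtractf flip: sum_distrib_left)
      thus ?thesis using \<beta> by (simp add: \<alpha>)
    qed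
    have rows: "(\<Sum>j<n. B (Suc i) j * B (Suc k) j) = (if i = k then 1 else 0) - 1 / d" if "i < n" "k < n" for i k
    proof -
      have "(\<Sum>j<n. B (Suc i) j * B (Suc k) j) = (\<Sum>j<n. (if j = i then if i = k then 1 else 0 else 0)
          - \<alpha> * (if j = i then 1 else 0) - \<alpha> * (if j = k then 1 else 0) + \<alpha> * \<alpha>)"
        unfolding BS by (intro sum.cong) (auto simp: algebra_simps)
      also have "\<dots> = (if i = k then 1 else 0) - \<alpha> - \<alpha> + n * (\<alpha> * \<alpha>)"
        using that by (simp add: sum.distrib sum_subtractf flip: sum_distrib_left)
      also have "\<dots> = (if i = k then 1 else 0) - \<beta> * \<beta>" using key by (simp add: mult.assoc)
      finally show ?thesis by (simp add: \<beta>)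
    qed
    show "(\<Sum>j<d-1. B i j * B k j) = (if i = k then 1 else 0) - 1 / d" if "i < d" "k < d" for i k
    proof (cases i; cases k)
      assume "i = 0" "k = 0"
      moreover have "n * (\<beta> * \<beta>) = 1 - 1 / d" unfolding \<beta> using n by (simp add: field_simps)
      ultimately show ?thesis unfolding d1 by (simp add: B0)
    next
      fix k' assume "i = 0" "k = Suc k'"
      thus ?thesis using row0[of k'] that n unfolding d1 by simp
    next
      fix i' assume "i = Suc i'" "k = 0"
      thus ?thesis using row0[of i'] that n unfolding d1 by (simp add: mult.commute)
    next
      fix i' k' assume "i = Suc i'" "k = Suc k'"
      thus ?thesis using rows[of i' k'] that n unfolding d1 by simp
    qed
  qed
qed

text \<open>The permutation representation on vectors of sum zero has dimension
  \<open>d - 1 > 0\<close> and, by transitivity, no invariant vectors. Written as matrices in an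
  orthonormal basis, it falls under the matrix case.\<close>

lemma (in nat_action) howe_moore_finite_orbit:
  assumes HM: "howe_moore TYPE('g)" and d: "d \<ge> 2"
    and inv: "\<And>g i. i < d \<Longrightarrow> act g i < d"
    and trans: "\<And>i j. i < d \<Longrightarrow> j < d \<Longrightarrow> \<exists>g. act g i = j"
  shows "compact (UNIV :: 'g set)"
proof -
  define e where "e = d - 1"
  obtain B :: "nat \<Rightarrow> nat \<Rightarrow> real" where
    B: "\<And>j. j < e \<Longrightarrow> (\<Sum>i<d. B i j) = 0"
    "\<And>j k. j < e \<Longrightarrow> k < e \<Longrightarrow> (\<Sum>i<d. B i j * B i k) = (if j = k then 1 else 0)"
    "\<And>i k. i < d \<Longrightarrow> k < d \<Longrightarrow> (\<Sum>j<e. B i j * B k j) = (if i = k then 1 else 0) - 1 / d"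
    using sum_zero_orthonormal_basis[OF d, folded e_def] by blast
  define b where "b i j = complex_of_real (B i j)" for i j
  have b0: "(\<Sum>i<d. b i j) = 0" if "j < e" for j
    using arg_cong[OF B(1)[OF that], of complex_of_real] by (simp add: b_def)
  have bc: "(\<Sum>i<d. b i j * b i k) = (if j = k then 1 else 0)" if "j < e" "k < e" for j k
    using arg_cong[OF B(2)[OF that], of complex_of_real] by (simp add: b_def)
  have br: "(\<Sum>j<e. b i j * b k j) = (if i = k then 1 else 0) - 1 / of_nat d" if "i < d" "k < d" for i k
    using arg_cong[OF B(3)[OF that], of complex_of_real] by (auto simp: b_def)
  have bij: "bij_betw (act g) {..<d} {..<d}" for g
    by (rule bij_betw_byWitness[of _ "act (- g)"]) (auto simp: inv)
  have reindex: "(\<Sum>i<d. f (act g i)) = (\<Sum>i<d. f i)" for g and f :: "nat \<Rightarrow> complex"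
    by (rule sum.reindex_bij_betw[OF bij])
  \<comment> \<open>The compression of the permutation matrix of g to the sum-zero space, in the
    basis given by the columns of b.\<close>
  define R where "R g j k = (\<Sum>i<d. b i j * b (act (- g) i) k)" for g j k
  \<comment> \<open>The product of b with its transpose is the identity minus the projection onto
    constants, so it fixes every vector of sum zero.\<close>
  have expand: "(\<Sum>k<e. b i k * (\<Sum>m<d. b m k * x m)) = x i"
    if "i < d" "(\<Sum>m<d. x m) = 0" for i and x :: "nat \<Rightarrow> complex"
  proof -
    have "(\<Sum>k<e. b i k * (\<Sum>m<d. b m k * x m)) = (\<Sum>k<e. \<Sum>m<d. b i k * b m k * x m)"
      by (simp add: sum_distrib_left mult.assoc)
    also have "\<dots> = (\<Sum>m<d. \<Sum>k<e. b i k * b m k * x m)" by (rule sum.swap)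
    also have "\<dots> = (\<Sum>m<d. (\<Sum>k<e. b i k * b m k) * x m)"
      by (simp add: sum_distrib_right)
    also have "\<dots> = (\<Sum>m<d. (if i = m then x m else 0) - x m / of_nat d)"
      using that(1) by (intro sum.cong refl) (auto simp only: br left_diff_distrib lessThan_iff; simp)
    also have "\<dots> = x i - (\<Sum>m<d. x m) / of_nat d"
      using that(1) by (simp add: sum_subtractf sum_divide_distrib)
    finally show ?thesis using that(2) by simp
  qed
  show ?thesis
  proof (rule howe_moore_matrix_rep[OF HM, of "e" R])
    show "0 < e" using d by (simp add: e_def)
    show "R (g + h) j l = (\<Sum>k<e. R g j k * R h k l)" if "j < e" "l < e" for g h j l
    proof -
      let ?x = "\<lambda>m. b (act (- h) m) l"
      have x0: "(\<Sum>m<d. ?x m) = 0" using reindex[of "\<lambda>m. b m l" "- h"] b0[OF that(2)] by simp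
      have "(\<Sum>k<e. R g j k * R h k l)
          = (\<Sum>k<e. \<Sum>i<d. b i j * (b (act (- g) i) k * (\<Sum>m<d. b m k * ?x m)))"
        by (simp add: R_def sum_distrib_right mult.assoc)
      also have "\<dots> = (\<Sum>i<d. \<Sum>k<e. b i j * (b (act (- g) i) k * (\<Sum>m<d. b m k * ?x m)))"
        by (rule sum.swap)
      also have "\<dots> = (\<Sum>i<d. b i j * (\<Sum>k<e. b (act (- g) i) k * (\<Sum>m<d. b m k * ?x m)))"
        by (simp only: sum_distrib_left)
      also have "\<dots> = (\<Sum>i<d. b i j * ?x (act (- g) i))"
        using x0 inv by (intro sum.cong refl arg_cong2[of _ _ _ _ "(*)"] expand) auto
      also have "\<dots> = R (g + h) j l"
        by (simp add: R_def minus_add act_add del: add_uminus_conv_diff)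
      finally show ?thesis by simp
    qed
    show "R 0 i j = (if i = j then 1 else 0)" if "i < e" "j < e" for i j
      using bc[OF that] by (simp add: R_def)
    show "R (- g) i j = cnj (R g j i)" for g i j
    proof -
      have "cnj (R g j i) = (\<Sum>m<d. b m j * b (act (- g) m) i)"
        by (simp add: R_def b_def)
      also have "\<dots> = (\<Sum>m<d. b (act g (act (- g) m)) j * b (act (- g) m) i)" by simp
      also have "\<dots> = (\<Sum>m<d. b (act g m) j * b m i)"
        by (rule reindex[of "\<lambda>m. b (act g m) j * b m i"])
      finally show ?thesis by (simp add: R_def mult.commute)
    qed
    show "((\<lambda>g. R g i j) \<longlongrightarrow> R g0 i j) (at g0)" for g0 i j
    proof (rule tendsto_eventually)
      \<comment> \<open>\<open>R g\<close> depends only on the finitely many values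
        \<open>act (- g) m\<close>, so it is locally constant in g.\<close>
      let ?W = "\<Inter>m\<in>{..<d}. {g. - g \<in> {h. act h m = act (- g0) m}}"
      have "open ?W" by (intro open_INT open_uminus_vimage ballI open_act_eq) auto
      moreover have "g0 \<in> ?W" by simp
      ultimately have "eventually (\<lambda>g. g \<in> ?W) (at g0)" unfolding eventually_at_topological by blast
      thus "eventually (\<lambda>g. R g i j = R g0 i j) (at g0)"
        by eventually_elim (auto simp: R_def)
    qed
    show "v k = 0" if v: "\<And>g i. i < e \<Longrightarrow> (\<Sum>j<e. R g i j * v j) = v i" and k: "k < e" for v k
    proof -
      \<comment> \<open>The sum-zero vector with coordinates v. Invariance makes it constant on the
        orbit, and its sum is zero, so it vanishes.\<close>
      define w where "w i = (\<Sum>k<e. b i k * v k)" for i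
      have Rw: "(\<Sum>k<e. R g j k * v k) = (\<Sum>i<d. b i j * w (act (- g) i))" for g j
      proof -
        have "(\<Sum>k<e. R g j k * v k) = (\<Sum>k<e. \<Sum>i<d. b i j * (b (act (- g) i) k * v k))"
          by (simp add: R_def sum_distrib_right mult.assoc)
        also have "\<dots> = (\<Sum>i<d. \<Sum>k<e. b i j * (b (act (- g) i) k * v k))" by (rule sum.swap)
        finally show ?thesis by (simp only: w_def sum_distrib_left)
      qed
      have w0: "(\<Sum>i<d. w i) = 0"
      proof -
        have "(\<Sum>i<d. w i) = (\<Sum>k<e. \<Sum>i<d. b i k * v k)" unfolding w_def by (rule sum.swap)
        also have "\<dots> = (\<Sum>k<e. (\<Sum>i<d. b i k) * v k)" by (simp only: sum_distrib_right)
        also have "\<dots> = 0" using b0 by (intro sum.neutral) auto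
        finally show ?thesis .
      qed
      have w_inv: "w (act (- g) i) = w i" if i: "i < d" for g i
      proof -
        have "(\<Sum>m<d. w (act (- g) m)) = 0" using reindex[of w "- g"] w0 by simp
        from expand[OF i this] have "(\<Sum>j<e. b i j * v j) = w (act (- g) i)"
          unfolding Rw[symmetric] using v by simp
        thus ?thesis by (simp add: w_def)
      qed
      have w_const: "w i = w 0" if "i < d" for i
      proof -
        obtain g where "act g 0 = i" using trans[of 0 i] \<open>i < d\<close> d by auto
        thus ?thesis using w_inv[of 0 "- g"] d by simp
      qed
      have "(\<Sum>i<d. w i) = (\<Sum>i<d. w 0)" by (intro sum.cong refl w_const) simp
      hence "w 0 = 0" using w0 d by simp
      hence w: "w i = 0" if "i < d" for i using w_const[OF that] by simp
      have "v k = (\<Sum>j<e. if k = j then v j else 0)" using k by simp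
      also have "\<dots> = (\<Sum>j<e. (\<Sum>i<d. b i k * b i j) * v j)"
        using k bc by (intro sum.cong refl) auto
      also have "\<dots> = (\<Sum>j<e. \<Sum>i<d. b i k * (b i j * v j))"
        by (simp add: sum_distrib_right mult.assoc)
      also have "\<dots> = (\<Sum>i<d. \<Sum>j<e. b i k * (b i j * v j))" by (rule sum.swap)
      also have "\<dots> = (\<Sum>i<d. b i k * w i)" by (simp only: w_def sum_distrib_left)
      also have "\<dots> = 0" using w by simp
      finally show ?thesis .
    qed
  qed
qed

text \<open>Copies the action from an invariant set X to Y. Indices outside Y are fixed, a filler
  that keeps the action defined on all natural numbers.\<close>

lemma nat_action_transport:
  fixes act :: "'g::topological_group_add \<Rightarrow> nat \<Rightarrow> nat"
  assumes act: "nat_action act" and inv: "\<And>g n. n \<in> X \<Longrightarrow> act g n \<in> X" and e: "bij_betw e Y X"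
  shows "nat_action (\<lambda>g k. if k \<in> Y then inv_into Y e (act g (e k)) else k)"
proof -
  interpret nat_action act by (rule act)
  have eX: "e k \<in> X" if "k \<in> Y" for k using e that by (auto simp: bij_betw_def)
  have i: "inv_into Y e x \<in> Y" "e (inv_into Y e x) = x" if "x \<in> X" for x
    using e that by (auto simp: bij_betw_def inv_into_into f_inv_into_f)
  have ie: "inv_into Y e (e k) = k" if "k \<in> Y" for k
    using e that by (auto simp: bij_betw_def)
  have eq: "{g. inv_into Y e (act g (e n)) = n} = {g. act g (e n) = e n}" if "n \<in> Y" for n
    using i(2)[OF inv[OF eX[OF that]]] ie[OF that] by (intro Collect_cong) metis
  show ?thesis
  proof
    show "open {g. (if n \<in> Y then inv_into Y e (act g (e n)) else n) = n}" for n
      using eq[of n] open_stab[of "e n"] by (cases "n \<in> Y") simp_all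
  qed (auto simp: ie act_add i inv eX)
qed

section \<open>Orthogonal representations on l_p\<close>

text \<open>The orbit of n is relabelled by an initial segment or by all natural numbers. It has at
  least two points, so if finite it would force G to be compact; if infinite, the transitive case
  applies and relabelling preserves the stabiliser.\<close>

lemma (in nat_action) howe_moore_stab:
  assumes HM: "howe_moore TYPE('g)" and nc: "\<not> compact (UNIV :: 'g set)" and n: "act g n \<noteq> n"
  shows "compact (stab n)"
proof -
  define X where "X = range (\<lambda>g. act g n)"
  have nX: "n \<in> X" unfolding X_def by (metis act_zero rangeI)
  have inv: "act h m \<in> X" if "m \<in> X" for h m
    using that by (auto simp: X_def simp flip: act_add)
  have trans: "\<exists>h. act h x = y" if xy: "x \<in> X" "y \<in> X" for x y
  proof -
    obtain a b where "x = act a n" "y = act b n" using xy by (auto simp: X_def)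
    hence "act (b + - a) x = y" by (simp add: act_add del: add_uminus_conv_diff)
    thus ?thesis by blast
  qed
  have transport: "\<exists>act'. nat_action act' \<and> (\<forall>h k. k \<in> Y \<longrightarrow> act' h k \<in> Y \<and> e (act' h k) = act h (e k))"
    if e: "bij_betw e Y X" for e Y
  proof (intro exI conjI allI impI)
    show "nat_action (\<lambda>g k. if k \<in> Y then inv_into Y e (act g (e k)) else k)"
      by (rule nat_action_transport[OF nat_action_axioms inv e])
    fix h k assume k: "k \<in> Y"
    hence "act h (e k) \<in> e ` Y" using e inv by (auto simp: bij_betw_def)
    thus "(if k \<in> Y then inv_into Y e (act h (e k)) else k) \<in> Y"
      "e (if k \<in> Y then inv_into Y e (act h (e k)) else k) = act h (e k)"
      using k by (simp_all add: inv_into_into f_inv_into_f)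
  qed
  show ?thesis
  proof (cases "finite X")
    case True
    obtain e where e: "bij_betw e {..<card X} X"
      using ex_bij_betw_nat_finite[OF True] by (auto simp: lessThan_atLeast0)
    then obtain act' where a': "nat_action act'"
      "\<And>h k. k < card X \<Longrightarrow> act' h k < card X" "\<And>h k. k < card X \<Longrightarrow> e (act' h k) = act h (e k)"
      using transport[OF e] by auto
    have "card {n, act g n} \<le> card X"
      by (rule card_mono[OF True]) (use nX inv in auto)
    hence "card X \<ge> 2" using n by simp
    have "compact (UNIV :: 'g set)"
    proof (rule nat_action.howe_moore_finite_orbit[OF a'(1) HM \<open>card X \<ge> 2\<close> a'(2)])
      fix i j assume ij: "i < card X" "j < card X"
      hence "e i \<in> X" "e j \<in> X" using e by (auto simp: bij_betw_def)
      then obtain h where "act h (e i) = e j" using trans by blast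
      hence "e (act' h i) = e j" using a'(3) ij by simp
      hence "act' h i = j" using e ij a'(2)[OF ij(1), of h] by (auto simp: bij_betw_def inj_on_def)
      thus "\<exists>g. act' g i = j" by blast
    qed
    with nc show ?thesis by blast
  next
    case False
    hence e: "bij_betw (from_nat_into X) UNIV X" by (intro bij_betw_from_nat_into) auto
    then obtain act' where a': "nat_action act'" "\<And>h k. from_nat_into X (act' h k) = act h (from_nat_into X k)"
      using transport[OF e] by auto
    have inj: "from_nat_into X i = from_nat_into X j \<longleftrightarrow> i = j" for i j
      using e by (auto simp: bij_betw_def inj_on_def)
    have mem: "from_nat_into X i \<in> X" for i using bij_betwE[OF e] by simp
    have "n \<in> range (from_nat_into X)" using e nX by (simp add: bij_betw_def)
    then obtain k where k: "from_nat_into X k = n" by blast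
    have "compact (nat_action.stab act' k)"
    proof (rule nat_action.howe_moore_transitive[OF a'(1) HM])
      fix i j
      obtain h where "act h (from_nat_into X i) = from_nat_into X j"
        using trans[OF mem mem] by blast
      hence "act' h i = j" using a'(2)[of h i] inj by simp
      thus "\<exists>g. act' g i = j" by blast
    qed
    moreover have "nat_action.stab act' k = stab n"
    proof -
      have "act' h k = k \<longleftrightarrow> act h n = n" for h using inj[of "act' h k" k] a'(2)[of h k] k by simp
      thus ?thesis by (simp add: stab_def nat_action.stab_def[OF a'(1)])
    qed
    ultimately show ?thesis by simp
  qed
qed

lemma norm_le_lpnorm:
  assumes p: "p > 0" and f: "f \<in> lp p"
  shows "norm (f n) \<le> lpnorm p f"
proof -
  have "norm (f n) powr p \<le> (\<Sum>n. norm (f n) powr p)"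
    using f sum_le_suminf[of "\<lambda>n. norm (f n) powr p" "{n}"] by (simp add: lp_def)
  hence "(norm (f n) powr p) powr (1 / p) \<le> lpnorm p f"
    unfolding lpnorm_def using p by (intro powr_mono2) auto
  thus ?thesis using p by (simp add: powr_powr)
qed

text \<open>Two unit vectors with different indices stay at distance at least 1 whatever their
  phases, so strong continuity makes \<open>act\<close> locally constant in g. The phases form a
  cocycle; continuity is stated at fixed points, where the cocycle becomes a character.\<close>

lemma orth_rep_monomial:
  fixes \<pi> :: "'g::topological_group_add \<Rightarrow> (nat \<Rightarrow> complex) \<Rightarrow> nat \<Rightarrow> complex"
  assumes p: "p > 0" "p \<noteq> 2" and \<pi>: "orth_rep p \<pi>"
  obtains act c where "nat_action act" "\<And>g n. norm (c g n) = 1"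
    "\<And>g f n. f \<in> lp p \<Longrightarrow> \<pi> g f (act g n) = c g n * f n"
    "\<And>n g0. \<forall>g. act g n = n \<Longrightarrow> ((\<lambda>g. c g n) \<longlongrightarrow> c g0 n) (at g0)"
proof -
  have iso: "lp_isometry p (\<pi> g)" and hom: "f \<in> lp p \<Longrightarrow> \<pi> (g + h) f = \<pi> g (\<pi> h f)"
    and zero: "f \<in> lp p \<Longrightarrow> \<pi> 0 f = f"
    and cont: "f \<in> lp p \<Longrightarrow> ((\<lambda>g. lpnorm p (\<lambda>n. \<pi> g f n - \<pi> g0 f n)) \<longlongrightarrow> 0) (at g0)" for g h g0 f
    using \<pi> unfolding orth_rep_def by blast+
  note \<pi>_lp = lp_isometry_in[OF iso]
  have inv: "\<pi> (- g) (\<pi> g f) = f" "\<pi> g (\<pi> (- g) f) = f" if "f \<in> lp p" for g f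
    using hom[OF that, of "- g" g] hom[OF that, of g "- g"] zero[OF that] by simp_all
  have "\<exists>\<sigma> c. bij \<sigma> \<and> (\<forall>n. norm (c n) = 1) \<and> (\<forall>f\<in>lp p. \<forall>n. \<pi> g f (\<sigma> n) = c n * f n)" for g
    using Banach_Lamperti[OF p iso[of g] iso[of "- g"] inv] by metis
  then obtain act c where bij: "\<And>g. bij (act g)" and c: "\<And>g n. norm (c g n :: complex) = 1"
    and act: "\<And>g f n. f \<in> lp p \<Longrightarrow> \<pi> g f (act g n) = c g n * f n" by metis
  have c0: "c g n \<noteq> 0" for g n using c[of g n] by auto
  \<comment> \<open>The index \<open>act g n\<close> is recovered as the support of the image of a
    unit vector; hence the action laws follow from those of \<open>\<pi>\<close>.\<close>
  have act_iff: "\<pi> g (unit_vec n) k \<noteq> 0 \<longleftrightarrow> k = act g n" for g n k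
  proof -
    obtain m where k: "k = act g m" using bij[of g] by (metis bij_pointE)
    have "act g m = act g n \<longleftrightarrow> m = n" using bij[of g] by (auto simp: bij_def inj_def)
    thus ?thesis unfolding k using act[of "unit_vec n" g m] c0[of g m] by (auto simp: unit_vec_def)
  qed
  have le: "norm (\<pi> g (unit_vec n) k - \<pi> g0 (unit_vec n) k) \<le> lpnorm p (\<lambda>k. \<pi> g (unit_vec n) k - \<pi> g0 (unit_vec n) k)"
    for g g0 n k
    by (rule norm_le_lpnorm[OF p(1) lp_diff[OF p(1) \<pi>_lp \<pi>_lp]]) simp_all
  have act_cont: "eventually (\<lambda>g. act g n = act g0 n) (at g0)" for n g0
  proof -
    have "eventually (\<lambda>g. lpnorm p (\<lambda>k. \<pi> g (unit_vec n) k - \<pi> g0 (unit_vec n) k) < 1) (at g0)"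
      by (rule order_tendstoD(2)[OF cont]) simp_all
    thus ?thesis
    proof eventually_elim
      case (elim g)
      show ?case
      proof (rule ccontr)
        assume "act g n \<noteq> act g0 n"
        hence "\<pi> g0 (unit_vec n) (act g n) = 0" using act_iff by blast
        thus False using le[of g n "act g n" g0] act[of "unit_vec n" g n] c[of g n] elim by simp
      qed
    qed
  qed
  have action: "nat_action act"
  proof
    show "act 0 n = n" for n
      using act_iff[of 0 n n] zero[of "unit_vec n"] by simp
    show "act (g + h) n = act g (act h n)" for g h n
    proof -
      have "\<pi> (g + h) (unit_vec n) (act g (act h n)) = c g (act h n) * (c h n * unit_vec n n)"
        by (simp add: hom act \<pi>_lp)
      hence "\<pi> (g + h) (unit_vec n) (act g (act h n)) \<noteq> 0" using c0 by simp
      thus ?thesis using act_iff by metis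
    qed
    show "open {g. act g n = n}" for n
    proof (subst open_subopen, intro ballI)
      fix g0 assume "g0 \<in> {g. act g n = n}"
      moreover obtain S where "open S" "g0 \<in> S" "\<forall>g\<in>S. g \<noteq> g0 \<longrightarrow> act g n = act g0 n"
        using act_cont[of n g0] unfolding eventually_at_topological by blast
      ultimately show "\<exists>T. open T \<and> g0 \<in> T \<and> T \<subseteq> {g. act g n = n}"
        by (intro exI[of _ S]) auto
    qed
  qed
  have c_cont: "((\<lambda>g. c g n) \<longlongrightarrow> c g0 n) (at g0)" if fixed: "\<forall>g. act g n = n" for n g0
  proof (rule LIM_zero_cancel, rule Lim_null_comparison)
    have "\<pi> g (unit_vec n) n = c g n" for g using act[of "unit_vec n" g n] fixed by simp
    thus "eventually (\<lambda>g. norm (c g n - c g0 n) \<le> lpnorm p (\<lambda>k. \<pi> g (unit_vec n) k - \<pi> g0 (unit_vec n) k)) (at g0)"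
      using le[of _ n n g0] by simp
    show "((\<lambda>g. lpnorm p (\<lambda>k. \<pi> g (unit_vec n) k - \<pi> g0 (unit_vec n) k)) \<longlongrightarrow> 0) (at g0)"
      by (rule cont) simp
  qed
  show ?thesis by (rule that[OF action c act c_cont])
qed

text \<open>This controls the map from \<open>l\<^sub>p\<close> to \<open>l\<^sub>1\<close> taking
  p-th powers of moduli. Let a be the larger number. Either b is so close to a that the powers
  differ by at most \<open>\<epsilon> * a powr p\<close>, or \<open>a - b\<close> is a definite
  fraction of a and dominates it.\<close>

lemma powr_diff_le:
  fixes p \<epsilon> :: real
  assumes p: "p > 0" and \<epsilon>: "0 < \<epsilon>" "\<epsilon> < 1"
  obtains C where "C \<ge> 0"
    "\<And>a b. a \<ge> 0 \<Longrightarrow> b \<ge> 0 \<Longrightarrow> \<bar>a powr p - b powr p\<bar> \<le> \<epsilon> * (a powr p + b powr p) + C * \<bar>a - b\<bar> powr p"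
proof -
  \<comment> \<open>The threshold ratio b/a at which the power has dropped by exactly the factor
    \<open>1 - \<epsilon>\<close>.\<close>
  define s where "s = (1 - \<epsilon>) powr (1 / p)"
  have s: "s powr p = 1 - \<epsilon>" "s > 0" using p \<epsilon> by (simp_all add: s_def powr_powr)
  have s1: "s < 1"
  proof (rule ccontr)
    assume "\<not> s < 1"
    hence "1 powr p \<le> s powr p" using p by (intro powr_mono2) auto
    thus False using s \<epsilon> by simp
  qed
  define C where "C = 1 / (1 - s) powr p"
  have C: "C \<ge> 0" by (simp add: C_def)
  have main: "a powr p - b powr p \<le> \<epsilon> * (a powr p + b powr p) + C * \<bar>a - b\<bar> powr p"
    if ab: "0 \<le> b" "b \<le> a" for a b :: real
  proof (cases "s * a \<le> b")
    case True
    hence "(s * a) powr p \<le> b powr p" using s ab p by (intro powr_mono2) auto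
    hence "(1 - \<epsilon>) * a powr p \<le> b powr p" using s by (simp add: powr_mult)
    moreover have "0 \<le> \<epsilon> * b powr p" "0 \<le> C * \<bar>a - b\<bar> powr p" using \<epsilon> C by simp_all
    ultimately show ?thesis by (simp add: algebra_simps)
  next
    case False
    hence "(1 - s) * a \<le> a - b" by (simp add: algebra_simps)
    hence "((1 - s) * a) powr p \<le> (a - b) powr p" using s1 ab p by (intro powr_mono2) auto
    hence "(1 - s) powr p * a powr p \<le> (a - b) powr p" by (simp add: powr_mult)
    hence "a powr p \<le> C * \<bar>a - b\<bar> powr p" using s1 ab by (simp add: C_def field_simps)
    moreover have "0 \<le> \<epsilon> * (a powr p + b powr p)" using \<epsilon> by simp
    moreover have "0 \<le> b powr p" by simp
    ultimately show ?thesis by linarith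
  qed
  have "\<bar>a powr p - b powr p\<bar> \<le> \<epsilon> * (a powr p + b powr p) + C * \<bar>a - b\<bar> powr p"
    if ab: "0 \<le> a" "0 \<le> b" for a b :: real
  proof (cases "b \<le> a")
    case True
    hence "b powr p \<le> a powr p" using ab p by (intro powr_mono2) auto
    thus ?thesis using main[OF ab(2) True] by simp
  next
    case False
    hence "a powr p \<le> b powr p" using ab p by (intro powr_mono2) auto
    thus ?thesis using main[OF ab(1), of b] False by (simp add: abs_minus_commute add.commute)
  qed
  with C show ?thesis using that by blast
qed

section \<open>Fixed coordinates, \<open>lp_prime\<close> and characters\<close>

lemma suminf_unit_vec_mult: "(\<Sum>k. unit_vec n k * h k) = h n" "(\<Sum>k. h k * unit_vec n k) = h n"
proof -
  have "(\<Sum>k. unit_vec n k * h k) = unit_vec n n * h n" by (rule suminf_single) simp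
  thus "(\<Sum>k. unit_vec n k * h k) = h n" by simp
  have "(\<Sum>k. h k * unit_vec n k) = h n * unit_vec n n" by (rule suminf_single) simp
  thus "(\<Sum>k. h k * unit_vec n k) = h n" by simp
qed

text \<open>If no \<open>\<pi> g\<close> changes the n-th coordinate, the n-th unit vector satisfies
  the defining property of its own dual image. Testing against unit vectors gives the uniqueness
  required by \<open>THE\<close>.\<close>

lemma lp_prime_vanishes:
  assumes inv: "\<And>g f. f \<in> lp p \<Longrightarrow> \<pi> g f n = f n" and f: "f \<in> lp_prime p \<pi>"
  shows "f n = 0"
proof -
  have "dual_rep p \<pi> g (unit_vec n) = unit_vec n" for g
    unfolding dual_rep_def
  proof (rule the_equality)
    show "unit_vec n \<in> lp (conj_exp p) \<and>
        (\<forall>f\<in>lp p. pairing f (unit_vec n) = pairing (\<pi> (- g) f) (unit_vec n))"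
      by (simp add: pairing_def suminf_unit_vec_mult inv)
  next
    fix h' assume h': "h' \<in> lp (conj_exp p) \<and> (\<forall>f\<in>lp p. pairing f h' = pairing (\<pi> (- g) f) (unit_vec n))"
    show "h' = unit_vec n"
    proof
      fix m
      have "pairing (unit_vec m) h' = pairing (\<pi> (- g) (unit_vec m)) (unit_vec n)" using h' by simp
      thus "h' m = unit_vec n m"
        by (simp add: pairing_def suminf_unit_vec_mult inv) (simp add: unit_vec_def)
    qed
  qed
  hence "pairing f (unit_vec n) = 0" using f by (simp add: lp_prime_def)
  thus ?thesis by (simp add: pairing_def suminf_unit_vec_mult)
qed

text \<open>A nontrivial character is a one-dimensional unitary matrix representation without
  nonzero invariant vectors, which would make G compact.\<close>

lemma howe_moore_character_trivial:
  fixes \<psi> :: "'g::topological_group_add \<Rightarrow> complex"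
  assumes HM: "howe_moore TYPE('g)" and nc: "\<not> compact (UNIV :: 'g set)"
    and hom: "\<And>g h. \<psi> (g + h) = \<psi> g * \<psi> h" and norm: "\<And>g. norm (\<psi> g) = 1"
    and cont: "\<And>g0. (\<psi> \<longlongrightarrow> \<psi> g0) (at g0)"
  shows "\<psi> g = 1"
proof (rule ccontr)
  assume g: "\<psi> g \<noteq> 1"
  have nz: "\<psi> g \<noteq> 0" for g using norm[of g] by auto
  have "\<psi> 0 * \<psi> 0 = \<psi> 0 * 1" using hom[of 0 0] by simp
  hence zero: "\<psi> 0 = 1" using nz by (metis mult_left_cancel)
  have "compact (UNIV :: 'g set)"
  proof (rule howe_moore_matrix_rep[OF HM, of 1 "\<lambda>g i j. \<psi> g"])
    show "\<psi> (- g) = cnj (\<psi> g)" for g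
    proof -
      have "\<psi> (- g) * \<psi> g = cnj (\<psi> g) * \<psi> g"
        using hom[of "- g" g] zero norm[of g] complex_norm_square[of "\<psi> g"] by (simp add: mult.commute)
      thus ?thesis using nz by simp
    qed
    show "v i = 0" if v: "\<And>g i. i < 1 \<Longrightarrow> (\<Sum>j<1. \<psi> g * v j) = v i" and i: "i < 1" for v :: "nat \<Rightarrow> complex" and i
    proof -
      have "\<psi> g * v 0 = v 0" using v[of 0 g] by simp
      thus ?thesis using g i by simp
    qed
  qed (auto simp: hom zero cont)
  with nc show False by blast
qed

section \<open>From almost invariance in l_p to almost invariance in l_1\<close>

lemma lpnorm_powr_tendsto_0:
  assumes p: "p > 0" and f: "\<And>k. f k \<in> lp p" and lim: "((\<lambda>k. lpnorm p (f k)) \<longlongrightarrow> 0) F"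
  shows "((\<lambda>k. \<Sum>n. norm (f k n) powr p) \<longlongrightarrow> 0) F"
proof -
  have "((\<lambda>k. lpnorm p (f k) powr p) \<longlongrightarrow> 0) F"
    using p by (intro tendsto_zero_powrI[OF lim tendsto_const]) (auto simp: lpnorm_def)
  thus ?thesis by (simp add: lpnorm_powr[OF p f])
qed

lemma powr_norm_almost_invariant:
  fixes F u :: "nat \<Rightarrow> nat \<Rightarrow> complex"
  assumes p: "p > 0" and F: "\<And>k. F k \<in> lp p" "\<And>k. lpnorm p (F k) = 1"
    and u: "\<And>k. u k \<in> lp p" "\<And>k. lpnorm p (u k) = 1"
    and lim: "(\<lambda>k. lpnorm p (\<lambda>n. u k n - F k n)) \<longlonglongrightarrow> 0"
  shows "(\<lambda>k. \<Sum>n. \<bar>norm (u k n) powr p - norm (F k n) powr p\<bar>) \<longlonglongrightarrow> 0"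
proof (rule tendstoI)
  let ?S = "\<lambda>k. \<Sum>n. \<bar>norm (u k n) powr p - norm (F k n) powr p\<bar>"
  let ?D = "\<lambda>k. \<Sum>n. norm (u k n - F k n) powr p"
  fix e :: real assume e: "e > 0"
  \<comment> \<open>Both vectors have norm 1, so the \<open>\<epsilon>\<close> term sums to
    \<open>2 * \<epsilon> \<le> e / 2\<close>; the bound 1/2 keeps \<open>\<epsilon>\<close> below
    1.\<close>
  define \<epsilon> where "\<epsilon> = min (1/2) (e / 4)"
  have \<epsilon>: "0 < \<epsilon>" "\<epsilon> < 1" "\<epsilon> \<le> e / 4" using e by (auto simp: \<epsilon>_def)
  obtain C where C: "C \<ge> 0"
    "\<And>a b. a \<ge> 0 \<Longrightarrow> b \<ge> 0 \<Longrightarrow> \<bar>a powr p - b powr p\<bar> \<le> \<epsilon> * (a powr p + b powr p) + C * \<bar>a - b\<bar> powr p"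
    using powr_diff_le[OF p \<epsilon>(1,2)] by blast
  have d: "(\<lambda>n. u k n - F k n) \<in> lp p" for k by (rule lp_diff[OF p u(1) F(1)])
  have "?D \<longlonglongrightarrow> 0" by (rule lpnorm_powr_tendsto_0[OF p d lim])
  hence "(\<lambda>k. C * ?D k) \<longlonglongrightarrow> 0" by (rule tendsto_mult_right_zero)
  hence "eventually (\<lambda>k. C * ?D k < e / 2) sequentially"
    by (rule order_tendstoD(2)) (use e in simp)
  thus "eventually (\<lambda>k. dist (?S k) 0 < e) sequentially"
  proof eventually_elim
    case (elim k)
    have s: "summable (\<lambda>n. norm (u k n) powr p)" "summable (\<lambda>n. norm (F k n) powr p)"
      "summable (\<lambda>n. norm (u k n - F k n) powr p)" using u F d[of k] by (auto simp: lp_def)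
    have one: "(\<Sum>n. norm (u k n) powr p) = 1" "(\<Sum>n. norm (F k n) powr p) = 1"
      using lpnorm_powr[OF p u(1), of k] lpnorm_powr[OF p F(1), of k] u(2)[of k] F(2)[of k] by simp_all
    let ?b = "\<lambda>n. \<epsilon> * (norm (u k n) powr p + norm (F k n) powr p) + C * norm (u k n - F k n) powr p"
    have le: "\<bar>norm (u k n) powr p - norm (F k n) powr p\<bar> \<le> ?b n" for n
    proof -
      have "\<bar>norm (u k n) - norm (F k n)\<bar> powr p \<le> norm (u k n - F k n) powr p"
        using p by (intro powr_mono2) (auto simp: norm_triangle_ineq3)
      from mult_left_mono[OF this C(1)] show ?thesis
        using C(2)[of "norm (u k n)" "norm (F k n)"] by simp
    qed
    have b: "?b sums (\<epsilon> * (1 + 1) + C * ?D k)"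
      using s one by (intro sums_add sums_mult) (simp_all add: sums_iff)
    have sS: "summable (\<lambda>n. \<bar>norm (u k n) powr p - norm (F k n) powr p\<bar>)"
      by (rule summable_comparison_test'[OF sums_summable[OF b], of 0]) (use le in simp)
    have "?S k \<le> \<epsilon> * (1 + 1) + C * ?D k"
      using suminf_le[OF le sS sums_summable[OF b]] sums_unique[OF b] by simp
    moreover have "0 \<le> ?S k" by (rule suminf_nonneg[OF sS]) simp
    ultimately show ?case using elim \<epsilon> by (simp add: dist_real_def)
  qed
qed

theorem theorem1p8:
  fixes G :: "'g::{topological_group_add, t2_space, second_countable_topology} itself"
  assumes "locally compact (UNIV :: 'g set)"
      and "totally_disconnected G"
      and "howe_moore G"
      and "\<not> amenable G"
      and "1 < p" and "p \<noteq> 2"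
  shows "property_T_lp p G"
  unfolding property_T_lp_def
proof (intro allI impI notI, elim exE conjE)
  have lc: "locally compact (UNIV :: 'g set)" and td: "totally_disconnected TYPE('g)"
    and HM: "howe_moore TYPE('g)" and na: "\<not> amenable TYPE('g)"
    using assms unfolding totally_disconnected_def howe_moore_def amenable_def by blast+
  have p: "p > 0" "p \<noteq> 2" using assms by auto
  have nc: "\<not> compact (UNIV :: 'g set)" using compact_imp_amenable[OF lc td] na by blast
  fix \<pi> :: "'g \<Rightarrow> (nat \<Rightarrow> complex) \<Rightarrow> nat \<Rightarrow> complex" and F
  assume \<pi>: "orth_rep p \<pi>" and F': "\<forall>k. F k \<in> lp_prime p \<pi>" and ai: "almost_invariant_seq p \<pi> F"
  have F: "F k \<in> lp p" "lpnorm p (F k) = 1" for k using ai by (auto simp: almost_invariant_seq_def)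
  have iso: "lp_isometry p (\<pi> g)" for g using \<pi> by (simp add: orth_rep_def)
  obtain act c where action: "nat_action act" and c: "\<And>g n. norm (c g n) = 1"
    and act: "\<And>g f n. f \<in> lp p \<Longrightarrow> \<pi> g f (act g n) = c g n * f n"
    and c_cont: "\<And>n g0. \<forall>g. act g n = n \<Longrightarrow> ((\<lambda>g. c g n) \<longlongrightarrow> c g0 n) (at g0)"
    using orth_rep_monomial[OF p \<pi>] by metis
  interpret nat_action act by (rule action)
  \<comment> \<open>Off X each phase is a character, hence trivial, so every \<open>F k\<close>
    lives on X, where stabilisers are compact.\<close>
  define X where "X = {n. \<exists>g. act g n \<noteq> n}"
  have F0: "F k n = 0" if n: "n \<notin> X" for k n
  proof (rule lp_prime_vanishes)
    have fixed: "act g n = n" for g using n by (simp add: X_def)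
    have \<pi>n: "\<pi> g f n = c g n * f n" if "f \<in> lp p" for g f
      using act[OF that, of g n] by (simp add: fixed)
    have hom: "c (g + h) n = c g n * c h n" for g h
    proof -
      have "\<pi> (g + h) (unit_vec n) = \<pi> g (\<pi> h (unit_vec n))" using \<pi> by (simp add: orth_rep_def)
      thus ?thesis using \<pi>n[of "unit_vec n" "g + h"] \<pi>n[of "unit_vec n" h] \<pi>n[OF lp_isometry_in[OF iso[of h]], of "unit_vec n" g] by simp
    qed
    have "c g n = 1" for g
      by (rule howe_moore_character_trivial[OF HM nc, of "\<lambda>g. c g n"])
        (use hom c c_cont fixed in blast)+
    thus "\<pi> g f n = f n" if "f \<in> lp p" for g f using \<pi>n[OF that] by simp
    show "F k \<in> lp_prime p \<pi>" using F' by blast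
  qed
  have "amenable TYPE('g)"
  proof (rule amenable_if_almost_invariant[of X "\<lambda>k n. norm (F k n) powr p"])
    show "act g n \<in> X" if "n \<in> X" for g n
    proof (rule ccontr)
      assume "act g n \<notin> X"
      hence *: "act h (act g n) = act g n" for h by (simp add: X_def)
      have "act g n = n" using *[of "- g"] by simp
      thus False using * that by (simp add: X_def)
    qed
    show "\<exists>M. mean_on (stab n) M \<and> (\<forall>f h. bcont f \<longrightarrow> h \<in> stab n \<longrightarrow> M (\<lambda>x. f (h + x)) = M f)"
      if "n \<in> X" for n
    proof -
      obtain g where "act g n \<noteq> n" using \<open>n \<in> X\<close> by (auto simp: X_def)
      from howe_moore_stab[OF HM nc this] compact_subgroup_invariant_mean[OF lc td open_subgroup_stab]
      show ?thesis by metis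
    qed
    show "(\<lambda>n. norm (F k n) powr p) sums 1" for k
      using F[of k] lpnorm_powr[OF p(1), of "F k"] by (simp add: lp_def sums_iff)
    show "(\<lambda>k. \<Sum>n. \<bar>norm (F k (act g n)) powr p - norm (F k n) powr p\<bar>) \<longlonglongrightarrow> 0" for g
    proof -
      \<comment> \<open>The inverse appears because the modulus of \<open>\<pi> (- g) (F k)\<close>
        at n is that of \<open>F k\<close> at \<open>act g n\<close>.\<close>
      let ?u = "\<lambda>k. \<pi> (- g) (F k)"
      have "norm (?u k n) = norm (F k (act g n))" for k n
        using act[OF F(1), of "- g" k "act g n"] c by (simp add: norm_mult)
      moreover have "(\<lambda>k. lpnorm p (\<lambda>n. ?u k n - F k n)) \<longlonglongrightarrow> 0"
      proof (rule tendstoI)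
        fix e :: real assume "e > 0"
        then obtain N where "\<forall>k\<ge>N. \<forall>h\<in>{- g}. lpnorm p (\<lambda>n. \<pi> h (F k) n - F k n) < e"
          using ai unfolding almost_invariant_seq_def by (meson compact_sing)
        thus "eventually (\<lambda>k. dist (lpnorm p (\<lambda>n. ?u k n - F k n)) 0 < e) sequentially"
          unfolding eventually_sequentially by (intro exI[of _ N]) (simp add: lpnorm_def)
      qed
      ultimately show ?thesis
        using powr_norm_almost_invariant[OF p(1) F, of ?u] lp_isometry_in[OF iso F(1)]
          lp_isometry_norm[OF iso F(1)] F(2) by simp
    qed
    show "norm (F k n) powr p = 0" if "n \<notin> X" for k n using F0[OF that] by simp
  qed simp
  with na show False by blast
qed

end
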